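(* Let $n\ge2$ and $y=\mu+\epsilon$ with $\mu\in\mathbb{R}^n$ unknown, $\epsilon\sim N(0,\sigma^2I)$ and $\sigma^2>0$ known. Run LARS on the reparametrized fused lasso system $(\tilde y,\tilde X)$, with knots $+\infty=\lambda_0>\lambda_1>\lambda_2>\cdots$ and entrants $(j_1,s_1),(j_2,s_2),\dots$. Assume generic position: at each step $k$ the maximizer of $|\tilde X_j^\top\tilde r^{(k-1)}|$ over inactive $j$ is unique. Fix a step $k$, let $\eta=\tilde c_k(j_k,s_k)$ and $\omega_k=\|\eta\|_2^{-1}$. Then, conditionally on having reached step $k$ with the entrants $(j_1,s_1),\dots,(j_k,s_k)$, the truncation interval for $\eta^\top y$ is $[\lambda_{k+1},\lambda_{k-1}]$, and under $H_0:\eta^\top\mu=0$ the statistic $$T_k=\frac{\Phi(\lambda_{k-1}\omega_k/\sigma)-\Phi(\lambda_k\omega_k/\sigma)}{\Phi(\lambda_{k-1}\omega_k/\sigma)-\Phi(\lambda_{k+1}\omega_k/\sigma)}$$ satisfies $T_k\sim U[0,1]$.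
   Context: **Reparametrization of the 1D fused lasso** (minimize $\frac12\|y-\mu\|_2^2+\lambda\|D\mu\|_1$ over $\mu\in\mathbb{R}^n$). $D\in\mathbb{R}^{(n-1)\times n}$ is the first-difference matrix, $(D\mu)_j=\mu_{j+1}-\mu_j$. Let $\mathbf 1_n$ be the all-ones vector, $\tilde D=\begin{bmatrix}D\\ \mathbf 1_n^\top\end{bmatrix}$ (invertible), $\tilde D^{-1}=[X_1\ X_2]$ with $X_1\in\mathbb{R}^{n\times(n-1)}$, $X_2\in\mathbb{R}^{n\times1}$, $P_2=X_2(X_2^\top X_2)^{-1}X_2^\top=\frac1n\mathbf 1_n\mathbf 1_n^\top$, $\tilde y=(I-P_2)y$, $\tilde X=(I-P_2)X_1$; $\tilde X_j$ is the $j$-th column of $\tilde X$ and $\tilde X_A$ the submatrix of columns indexed by $A$. **LARS for $(\tilde y,\tilde X)$.** Start with $\mathcal M_0=\emptyset$, residual $\tilde y$, $\lambda_0=+\infty$. Put $\lambda_1=\max_j|\tilde X_j^\top\tilde y|$, $j_1$ a maximizer, $s_1=\mathrm{sign}(\tilde X_{j_1}^\top\tilde y)$, $\mathcal M_1=\{j_1\}$. For $k\ge2$, with $A=\mathcal M_{k-1}$ and $s_A=(s_1,\dots,s_{k-1})^\top$, for $\lambda\le\lambda_{k-1}$ the residual is $\tilde r(\lambda)=\tilde y-\tilde X_A(\tilde X_A^\top\tilde X_A)^{-1}(\tilde X_A^\top\tilde y-\lambda s_A)$. The knot $\lambda_k$ is the largest $\lambda<\lambda_{k-1}$ at which some $j\notin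 A$ attains $|\tilde X_j^\top\tilde r(\lambda)|=\lambda$; $j_k$ is such an index, $s_k=\mathrm{sign}(\tilde X_{j_k}^\top\tilde r(\lambda_k))$, $\mathcal M_k=A\cup\{j_k\}$. By convention $\lambda_{k+1}:=0$ when $k$ is the last step. Here $\tilde r^{(k-1)}=\tilde r(\lambda_k)$ is the residual with active set $\mathcal M_{k-1}$ at the moment the $k$-th variable enters (for $k=1$, $\tilde r^{(0)}=\tilde y$); "inactive" means $j\notin\mathcal M_{k-1}$. **The vectors $\tilde c_k$.** With $A=\mathcal M_{k-1}$ and $\tilde P_A=\tilde X_A(\tilde X_A^\top\tilde X_A)^{-1}\tilde X_A^\top$, for $j\notin A$ and $s\in\{-1,1\}$, $$\tilde c_k(j,s)=\frac{(I-\tilde P_A)\tilde X_j}{s-\tilde X_j^\top\tilde X_A(\tilde X_A^\top\tilde X_A)^{-1}s_A}$$ (for $k=1$, $\tilde c_1(j,s)=\tilde X_j/s$). One has $\tilde c_k(j_k,s_k)^\top\tilde y=\lambda_k$. Conditioning on the entrants fixes $\eta$. **Conventions.** $\Phi$ is the standard normal CDF, $\Phi(+\infty)=1$. "The truncation interval for $\eta^\top y$ is $[a,b]$" means that, conditionally on the selection event and on the component $z=(I-\eta\eta^\top/\|\eta\|_2^2)y$, which is independent of $\eta^\top y$, the statistic $\eta^\top y$ follows $N(\eta^\top\mu,\sigma^2\|\eta\|_2^2)$ truncated to $[a,b]$. $U[0,1]$ is the uniform distribution on $[0,1]$. *)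

theory Defs
  imports "HOL-Probability.Probability"
begin

section \<open>The reparametrized fused lasso design\<close>

text \<open>
  The coordinates \<open>1, \<dots>, n\<close> are the elements of a finite well-ordered index type \<open>'n\<close>.
  The \<open>n - 1\<close> difference rows of \<open>D\<close> are indexed by the coordinates other than the last one,
  which leaves the last index for the row of ones in \<open>Dtilde\<close>.
\<close>

definition last_ix :: "'n::{finite,wellorder}" where
  "last_ix = Max UNIV"

definition next_ix :: "'n::{finite,wellorder} \<Rightarrow> 'n" where
  "next_ix j = (LEAST i. j < i)"

definition diff_ix :: "'n::{finite,wellorder} set" where
  "diff_ix = UNIV - {last_ix}"

definition Dtilde :: "real^'n::_^'n::{finite,wellorder}" where
  "Dtilde = (\<chi> j i. if j = last_ix then 1
                    else (if i = next_ix j then 1 else 0) - (if i = j then 1 else 0))"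

definition X1 :: "'n::{finite,wellorder} \<Rightarrow> real^'n::_" where
  "X1 j = column j (matrix_inv Dtilde)"

definition X2 :: "real^'n::{finite,wellorder}" where
  "X2 = column last_ix (matrix_inv Dtilde)"

definition P2 :: "real^'n::_^'n::{finite,wellorder}" where
  "P2 = (let u = X2 :: real^'n::_ in \<chi> i l. u $ i * inverse (u \<bullet> u) * u $ l)"

definition ytilde :: "real^'n::{finite,wellorder} \<Rightarrow> real^'n::_" where
  "ytilde y = (mat 1 - P2) *v y"

text \<open>Meaningful for \<open>j \<in> diff_ix\<close>.\<close>

definition Xtilde :: "'n::{finite,wellorder} \<Rightarrow> real^'n::_" where
  "Xtilde j = (mat 1 - P2) *v X1 j"


section \<open>Least squares on a set of columns\<close>

text \<open>
  A design matrix is the family \<open>X\<close> of its columns.  Since the active set varies, a matrix over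
  \<open>A \<times> A\<close> is a function of two indices of which only the values on \<open>A\<close> matter;
  \<open>inv_on\<close> is \<open>matrix_inv\<close> for such matrices.
\<close>

definition inv_on :: "'i set \<Rightarrow> ('i \<Rightarrow> 'i \<Rightarrow> real) \<Rightarrow> 'i \<Rightarrow> 'i \<Rightarrow> real" where
  "inv_on A G = (SOME H. \<forall>a\<in>A. \<forall>c\<in>A.
      (\<Sum>b\<in>A. G a b * H b c) = (if a = c then 1 else 0) \<and>
      (\<Sum>b\<in>A. H a b * G b c) = (if a = c then 1 else 0))"

text \<open>\<open>lsq X A w\<close> is the vector \<open>X\<^sub>A (X\<^sub>A\<^sup>T X\<^sub>A)\<^sup>-\<^sup>1 w\<close>, where \<open>w\<close> is a vector over \<open>A\<close>.\<close>

definition lsq :: "('i \<Rightarrow> 'v::real_inner) \<Rightarrow> 'i set \<Rightarrow> ('i \<Rightarrow> real) \<Rightarrow> 'v" where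
  "lsq X A w = (\<Sum>a\<in>A. (\<Sum>b\<in>A. inv_on A (\<lambda>i j. X i \<bullet> X j) a b * w b) *\<^sub>R X a)"

definition proj_on :: "('i \<Rightarrow> 'v::real_inner) \<Rightarrow> 'i set \<Rightarrow> 'v \<Rightarrow> 'v" where
  "proj_on X A v = lsq X A (\<lambda>a. X a \<bullet> v)"


section \<open>LARS\<close>

text \<open>
  The list \<open>es = [(j\<^sub>1, s\<^sub>1), \<dots>, (j\<^sub>k, s\<^sub>k)]\<close> records the entrants in order.  \<open>J\<close> is the finite set of
  column indices, \<open>y\<close> the response.
\<close>

definition active :: "('i \<times> real) list \<Rightarrow> 'i set" where
  "active es = fst ` set es"

definition sign_of :: "('i \<times> real) list \<Rightarrow> 'i \<Rightarrow> real" where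
  "sign_of es a = the (map_of es a)"

definition lars_resid :: "('i \<Rightarrow> 'v::real_inner) \<Rightarrow> 'v \<Rightarrow> ('i \<times> real) list \<Rightarrow> real \<Rightarrow> 'v" where
  "lars_resid X y es l = y - lsq X (active es) (\<lambda>a. X a \<bullet> y - l * sign_of es a)"

definition lars_crossings ::
    "('i \<Rightarrow> 'v::real_inner) \<Rightarrow> 'i set \<Rightarrow> 'v \<Rightarrow> ('i \<times> real) list \<Rightarrow> ereal \<Rightarrow> real set" where
  "lars_crossings X J y es u =
     {l. ereal l < u \<and> (\<exists>j\<in>J - active es. \<bar>X j \<bullet> lars_resid X y es l\<bar> = l)}"

definition has_greatest :: "real set \<Rightarrow> bool" where
  "has_greatest S \<longleftrightarrow> (\<exists>m\<in>S. \<forall>x\<in>S. x \<le> m)"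

text \<open>
  \<open>lars_knot X J y es k\<close> is \<open>\<lambda>\<^sub>k\<close> when the first \<open>k - 1\<close> entrants are those listed in \<open>es\<close>.
  It is \<open>0\<close> when there is no further knot.
\<close>

fun lars_knot ::
    "('i \<Rightarrow> 'v::real_inner) \<Rightarrow> 'i set \<Rightarrow> 'v \<Rightarrow> ('i \<times> real) list \<Rightarrow> nat \<Rightarrow> ereal" where
  "lars_knot X J y es 0 = \<infinity>"
| "lars_knot X J y es (Suc 0) = ereal (Max ((\<lambda>j. \<bar>X j \<bullet> y\<bar>) ` J))"
| "lars_knot X J y es (Suc (Suc i)) =
     (let S = lars_crossings X J y (take (Suc i) es) (lars_knot X J y es (Suc i))
      in if has_greatest S then ereal (GREATEST l. l \<in> S) else 0)"

text \<open>The residual at the moment the entrant \<open>es ! i\<close> joins (for \<open>i = 0\<close> it is \<open>y\<close>).\<close>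

definition entry_resid ::
    "('i \<Rightarrow> 'v::real_inner) \<Rightarrow> 'i set \<Rightarrow> 'v \<Rightarrow> ('i \<times> real) list \<Rightarrow> nat \<Rightarrow> 'v" where
  "entry_resid X J y es i =
     lars_resid X y (take i es) (real_of_ereal (lars_knot X J y es (Suc i)))"

text \<open>
  LARS on \<open>(y, X)\<close> reaches step \<open>length es\<close> with the entrants \<open>es\<close>.  Several lists of the same
  length qualify only when there are ties.  The clause on \<open>has_greatest\<close> says that the knot
  exists, as opposed to being \<open>0\<close> by convention.
\<close>

definition lars_reaches ::
    "('i \<Rightarrow> 'v::real_inner) \<Rightarrow> 'i set \<Rightarrow> 'v \<Rightarrow> ('i \<times> real) list \<Rightarrow> bool" where
  "lars_reaches X J y es \<longleftrightarrow> (\<forall>i<length es.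
     let (j, s) = es ! i; r = entry_resid X J y es i in
       (i > 0 \<longrightarrow> has_greatest (lars_crossings X J y (take i es) (lars_knot X J y es i))) \<and>
       j \<in> J - active (take i es) \<and>
       ereal \<bar>X j \<bullet> r\<bar> = lars_knot X J y es (Suc i) \<and>
       s = sgn (X j \<bullet> r))"

definition lars_generic :: "('i \<Rightarrow> 'v::real_inner) \<Rightarrow> 'i set \<Rightarrow> 'v \<Rightarrow> bool" where
  "lars_generic X J y \<longleftrightarrow> (\<forall>es. lars_reaches X J y es \<longrightarrow> (\<forall>i<length es.
     \<exists>!j. is_arg_max (\<lambda>j. \<bar>X j \<bullet> entry_resid X J y es i\<bar>) (\<lambda>j. j \<in> J - active (take i es)) j))"

text \<open>The argument \<open>es\<close> lists the entrants of the steps before the one at which \<open>(j, s)\<close> competes.\<close>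

definition lars_c ::
    "('i \<Rightarrow> 'v::real_inner) \<Rightarrow> ('i \<times> real) list \<Rightarrow> 'i \<Rightarrow> real \<Rightarrow> 'v" where
  "lars_c X es j s =
     (X j - proj_on X (active es) (X j)) /\<^sub>R (s - X j \<bullet> lsq X (active es) (sign_of es))"


section \<open>Truncated normal laws and truncation intervals\<close>

definition Phi :: "ereal \<Rightarrow> real" where
  "Phi x = (if x = \<infinity> then 1 else if x = -\<infinity> then 0
            else cdf std_normal_distribution (real_of_ereal x))"

text \<open>\<open>N(m, s\<^sup>2)\<close> truncated to \<open>[a, b]\<close>; \<open>s\<close> is the standard deviation.\<close>

definition trunc_normal :: "real \<Rightarrow> real \<Rightarrow> ereal \<Rightarrow> ereal \<Rightarrow> real measure" where
  "trunc_normal m s a b =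
     uniform_measure (density lborel (normal_density m s)) {x. a \<le> ereal x \<and> ereal x \<le> b}"

definition orth_part :: "'v::real_inner \<Rightarrow> 'v \<Rightarrow> 'v" where
  "orth_part \<eta> v = v - ((\<eta> \<bullet> v) / (norm \<eta>)\<^sup>2) *\<^sub>R \<eta>"

text \<open>
  For \<open>y \<sim> N(\<mu>, \<sigma>\<^sup>2 I)\<close> under \<open>M\<close>: given the event \<open>E\<close> and \<open>z = orth_part \<eta> y\<close>, which is independent
  of \<open>\<eta> \<bullet> y\<close> under \<open>M\<close>, the law of \<open>\<eta> \<bullet> y\<close> is \<open>N(\<eta> \<bullet> \<mu>, \<sigma>\<^sup>2 (norm \<eta>)\<^sup>2)\<close> truncated to \<open>[a, b]\<close>.
  The end points are random; no measurability of them is presupposed.  The last conjunct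
  makes the displayed law a version of a conditional probability given \<open>z\<close>, so it determines
  the end points up to null sets as functions of \<open>z\<close>.
\<close>

definition truncation_interval ::
    "'w measure \<Rightarrow> 'w set \<Rightarrow> ('w \<Rightarrow> 'v::euclidean_space) \<Rightarrow> 'v \<Rightarrow> real \<Rightarrow> 'v \<Rightarrow>
     ('w \<Rightarrow> ereal) \<Rightarrow> ('w \<Rightarrow> ereal) \<Rightarrow> bool" where
  "truncation_interval M E y \<mu> \<sigma> \<eta> a b \<longleftrightarrow>
     (let z = (\<lambda>\<omega>. orth_part \<eta> (y \<omega>)); Q = uniform_measure M E in
       prob_space.indep_set M (sets (vimage_algebra (space M) (\<lambda>\<omega>. \<eta> \<bullet> y \<omega>) borel))
                            (sets (vimage_algebra (space M) z borel)) \<and>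
       (\<forall>B\<in>sets borel. AE \<omega> in Q.
          real_cond_exp Q (vimage_algebra (space Q) z borel)
              (indicator {\<omega> \<in> space Q. \<eta> \<bullet> y \<omega> \<in> B}) \<omega>
          = measure (trunc_normal (\<eta> \<bullet> \<mu>) (\<sigma> * norm \<eta>) (a \<omega>) (b \<omega>)) B))"

end

theory Submission
  imports Defs
begin

text \<open>
  The columns \<open>Xtilde j\<close> are step functions of mean zero with a single jump, of height one, at \<open>j\<close>.
  A vector in the span of the columns of \<open>A\<close> is therefore constant between consecutive elements of \<open>A\<close>,
  so its correlations \<open>Xtilde j \<bullet> v\<close>, which are its tail sums, are linear in \<open>j\<close> between these elements and
  vanish at both ends.  Such a function attains its extreme values on \<open>A\<close>
  (\<open>Xtilde_abs_maximum_principle\<close>).  Hence along a LARS path with active signs \<open>s\<close> the correlation of an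
  inactive column with the residual is \<open>level + l * slope\<close> with \<open>\<bar>slope\<bar> \<le> 1\<close>.

  From \<open>\<bar>slope\<bar> \<le> 1\<close> it follows that an inactive column that is below the bound \<open>l\<close> in absolute correlation was
  below the bound at all larger values of \<open>l\<close> (\<open>gap_mono\<close>).  So the competitions at the earlier steps are
  implied by the last one, and LARS reaches step \<open>k\<close> with the prescribed entrants exactly if the
  hypothetical knots \<open>c\<^sub>1 \<bullet> y > \<dots> > c\<^sub>k \<bullet> y\<close> decrease and, at \<open>l = c\<^sub>k \<bullet> y\<close>, all columns still inactive after step
  \<open>k\<close> are strictly below the bound (\<open>reaches_iff\<close>).  The latter says that \<open>c\<^sub>k \<bullet> y\<close> exceeds the next knot, which is
  computed from the residual of the projection on all \<open>k\<close> active columns, up to sign conditions on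
  that residual.

  With \<open>\<eta> = c\<^sub>k\<close> in the span of the active columns and orthogonal to \<open>c\<^sub>1, \<dots>, c\<^sub>k\<^sub>-\<^sub>1\<close>, everything except
  \<open>c\<^sub>k \<bullet> y = \<eta> \<bullet> y\<close> is a function of \<open>z = orth_part \<eta> y\<close>.  The selection event is
  thus, up to a null set, of the form \<open>z \<in> C\<close> and \<open>L z < \<eta> \<bullet> y < U z\<close>, where \<open>L z\<close> and \<open>U z\<close> are the knots
  \<open>k + 1\<close> and \<open>k - 1\<close> (\<open>reaches_iff_interval\<close>, \<open>lars_knots_at_reached\<close>, \<open>selection_cong\<close>).

  Since \<open>\<eta> \<bullet> y\<close> is normal and independent of \<open>z\<close> (\<open>isotropic_direction\<close>), Fubini's theorem gives the truncated
  normal law given \<open>z\<close> (\<open>conditional_law\<close>), and the probability integral transform for that law makes the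
  pivot uniform given almost every value of \<open>z\<close>, hence uniform (\<open>pivot_uniform\<close>).
\<close>

section \<open>The columns of the reparametrized design\<close>

lemma diff_ix_iff: "j \<in> diff_ix \<longleftrightarrow> j \<noteq> last_ix"
  by (simp add: diff_ix_def)

lemma le_last_ix: "j \<le> last_ix"
  by (simp add: last_ix_def)

lemma less_next_ix:
  assumes "j \<in> diff_ix"
  shows "j < next_ix j"
proof -
  have "j < last_ix"
    using assms le_last_ix[of j] by (auto simp: diff_ix_iff)
  then show ?thesis
    unfolding next_ix_def by (rule LeastI)
qed

lemma next_ix_le: "j < i \<Longrightarrow> next_ix j \<le> i"
  unfolding next_ix_def by (rule Least_le)

lemma greaterThan_eq_next_ix:
  assumes "j \<in> diff_ix"
  shows "{j<..} = {next_ix j..}"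
  using less_next_ix[OF assms] next_ix_le by (auto intro: less_le_trans)

lemma next_ix_surj:
  fixes i l :: "'n::{finite,wellorder}"
  assumes "l < i"
  obtains j where "j \<in> diff_ix" "next_ix j = i"
proof
  define j where "j = Max {..<i}"
  have ne: "{..<i} \<noteq> {}" using assms by auto
  have ji: "j < i" using Max_in[OF _ ne] by (simp add: j_def)
  show jd: "j \<in> diff_ix"
    using ji le_last_ix[of i] by (auto simp: diff_ix_iff)
  have "\<not> next_ix j < i"
  proof
    assume "next_ix j < i"
    then have "next_ix j \<le> j" by (simp add: j_def)
    then show False using less_next_ix[OF jd] by simp
  qed
  then show "next_ix j = i"
    using next_ix_le[OF ji] by auto
qed

lemma Dtilde_row:
  fixes x :: "real^'n::{finite,wellorder}"
  shows "(Dtilde *v x) $ j = (if j = last_ix then \<Sum>i\<in>UNIV. x $ i else x $ next_ix j - x $ j)"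
  by (simp add: Dtilde_def matrix_vector_mult_def algebra_simps sum.distrib sum_subtractf
      if_distrib[where f="\<lambda>u. _ * u"] cong: if_cong)

text \<open>
  The largest coordinate whose value differs from the last one would be followed by a jump.
\<close>

lemma const_if_no_jumps:
  fixes x :: "real^'n::{finite,wellorder}"
  assumes "\<And>j. j \<in> diff_ix \<Longrightarrow> x $ next_ix j = x $ j"
  shows "x $ i = x $ last_ix"
proof (rule ccontr)
  assume ne: "x $ i \<noteq> x $ last_ix"
  define m where "m = Max {i. x $ i \<noteq> x $ last_ix}"
  have "m \<in> {i. x $ i \<noteq> x $ last_ix}"
    unfolding m_def by (rule Max_in) (use ne in auto)
  then have m: "x $ m \<noteq> x $ last_ix" by simp
  then have md: "m \<in> diff_ix" by (auto simp: diff_ix_iff)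
  have "x $ next_ix m \<noteq> x $ last_ix"
    using assms[OF md] m by simp
  then have "next_ix m \<le> m"
    unfolding m_def by (intro Max_ge) auto
  then show False
    using less_next_ix[OF md] by simp
qed

lemma Dtilde_inverse: "Dtilde ** matrix_inv Dtilde = mat 1"
proof -
  have "\<forall>x::real^'n::{finite,wellorder}. Dtilde *v x = 0 \<longrightarrow> x = 0"
  proof (intro allI impI)
    fix x :: "real^'n::{finite,wellorder}"
    assume 0: "Dtilde *v x = 0"
    have "x $ i = x $ last_ix" for i
    proof (rule const_if_no_jumps)
      fix j :: 'n assume "j \<in> diff_ix"
      then show "x $ next_ix j = x $ j"
        using arg_cong[OF 0, of "\<lambda>v. v $ j"] by (simp add: Dtilde_row diff_ix_iff)
    qed
    then have c: "x = (\<chi> i. x $ last_ix)" by (simp add: vec_eq_iff)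
    have "(\<Sum>i\<in>UNIV. x $ i) = 0"
      using arg_cong[OF 0, of "\<lambda>v. v $ last_ix"] by (simp add: Dtilde_row)
    then have "of_nat CARD('n) * x $ last_ix = 0"
      by (subst (asm) c) simp
    then show "x = 0" by (subst c) (simp add: vec_eq_iff)
  qed
  then have "invertible (Dtilde :: real^'n::_^'n::{finite,wellorder})"
    by (simp add: invertible_left_inverse matrix_left_invertible_ker)
  then show ?thesis
    unfolding invertible_def matrix_inv_def by (rule someI_ex[THEN conjunct1])
qed

lemma Dtilde_column_inverse: "Dtilde *v column j (matrix_inv Dtilde) = axis j 1"
proof -
  have "Dtilde *v column j (matrix_inv Dtilde) = column j (Dtilde ** matrix_inv Dtilde)"
    by (simp add: vec_eq_iff column_def matrix_matrix_mult_def matrix_vector_mult_def)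
  then show ?thesis
    by (simp add: Dtilde_inverse column_def mat_def axis_def vec_eq_iff)
qed

lemma sum_X1:
  assumes "j \<in> diff_ix"
  shows "(\<Sum>i\<in>UNIV. X1 j $ i) = 0"
  using arg_cong[OF Dtilde_column_inverse[of j], of "\<lambda>v. v $ last_ix"] assms
  by (simp add: Dtilde_row X1_def axis_def diff_ix_iff split: if_splits)

lemma jump_X1:
  assumes "l \<in> diff_ix"
  shows "X1 j $ next_ix l - X1 j $ l = (if l = j then 1 else 0)"
  using arg_cong[OF Dtilde_column_inverse[of j], of "\<lambda>v. v $ l"] assms
  by (simp add: Dtilde_row X1_def axis_def diff_ix_iff split: if_splits)

lemma X2_const:
  obtains c where "X2 = (\<chi> i::'n::{finite,wellorder}. c)"
proof
  let ?x = "X2 :: real^'n::_"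
  have "?x $ i = ?x $ last_ix" for i
  proof (rule const_if_no_jumps)
    fix j :: 'n assume "j \<in> diff_ix"
    then show "?x $ next_ix j = ?x $ j"
      using arg_cong[OF Dtilde_column_inverse[of last_ix], of "\<lambda>v. v $ j"]
      by (simp add: Dtilde_row X2_def axis_def diff_ix_iff)
  qed
  then show "?x = (\<chi> i. ?x $ last_ix)" by (simp add: vec_eq_iff)
qed

lemma P2_const:
  obtains a where "\<And>v::real^'n::{finite,wellorder}. P2 *v v = (\<chi> i. a * (\<Sum>l\<in>UNIV. v $ l))"
proof -
  obtain c where c: "X2 = (\<chi> i::'n. c)" by (rule X2_const)
  have "P2 *v v = (\<chi> i. (c * inverse (X2 \<bullet> (X2 :: real^'n::_)) * c) * (\<Sum>l\<in>UNIV. v $ l))"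
    for v :: "real^'n::_"
    by (simp add: P2_def Let_def vec_eq_iff matrix_vector_mult_def sum_distrib_left c)
  then show ?thesis by (rule that)
qed

text \<open>
  The bottom row of \<open>Dtilde\<close> forces the columns of \<open>X1\<close> to have mean zero, and \<open>P2\<close> is a multiple of
  the averaging projection, so it annihilates them.
\<close>

lemma Xtilde_eq_X1:
  fixes j :: "'n::{finite,wellorder}"
  assumes "j \<in> diff_ix"
  shows "Xtilde j = X1 j"
proof -
  obtain a where a: "\<And>v::real^'n::_. P2 *v v = (\<chi> i. a * (\<Sum>l\<in>UNIV. v $ l))"
    using P2_const by blast
  show ?thesis
    by (simp add: Xtilde_def matrix_vector_mult_diff_rdistrib a sum_X1[OF assms] vec_eq_iff)
qed

lemma sum_Xtilde:
  assumes "j \<in> diff_ix"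
  shows "(\<Sum>i\<in>UNIV. Xtilde j $ i) = 0"
  using sum_X1 assms by (simp add: Xtilde_eq_X1)

lemma jump_Xtilde:
  assumes "l \<in> diff_ix" "j \<in> diff_ix"
  shows "Xtilde j $ next_ix l - Xtilde j $ l = (if l = j then 1 else 0)"
  using jump_X1[of l j] assms by (simp add: Xtilde_eq_X1)

text \<open>
  Centring the response is invisible to the centred columns; this lets \<open>y\<close> replace \<open>ytilde y\<close> in every
  quantity that LARS computes.
\<close>

lemma Xtilde_inner_ytilde:
  fixes v :: "real^'n::{finite,wellorder}"
  assumes "j \<in> diff_ix"
  shows "Xtilde j \<bullet> ytilde v = Xtilde j \<bullet> v"
proof -
  obtain a where a: "\<And>v::real^'n::_. P2 *v v = (\<chi> i. a * (\<Sum>l\<in>UNIV. v $ l))"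
    using P2_const by blast
  have "Xtilde j \<bullet> (\<chi> i. b) = 0" for b
    using sum_Xtilde[OF assms] by (simp add: inner_vec_def sum_distrib_right[symmetric])
  then show ?thesis
    by (simp add: ytilde_def matrix_vector_mult_diff_rdistrib a inner_diff_right)
qed

text \<open>
  Up to an additive constant \<open>Xtilde j\<close> is the indicator of the coordinates after \<open>j\<close>, because both have the
  same jumps.
\<close>

lemma Xtilde_inner:
  fixes v :: "real^'n::{finite,wellorder}"
  assumes j: "j \<in> diff_ix" and v: "(\<Sum>i\<in>UNIV. v $ i) = 0"
  shows "Xtilde j \<bullet> v = (\<Sum>i\<in>{j<..}. v $ i)"
proof -
  define x :: "real^'n::_" where "x = (\<chi> i. if j < i then 1 else 0)"
  have "(Xtilde j - x) $ i = (Xtilde j - x) $ last_ix" for i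
  proof (rule const_if_no_jumps)
    fix l :: 'n assume l: "l \<in> diff_ix"
    have "j < next_ix l \<longleftrightarrow> j \<le> l"
      using less_next_ix[OF l] next_ix_le[of l j] by (auto simp: not_less[symmetric] intro: le_less_trans)
    then show "(Xtilde j - x) $ next_ix l = (Xtilde j - x) $ l"
      using jump_Xtilde[OF l j] by (auto simp: x_def)
  qed
  then have "Xtilde j $ i = x $ i + (Xtilde j - x) $ last_ix" for i
    by (metis add.commute diff_add_cancel vector_minus_component)
  then have "Xtilde j \<bullet> v = (\<Sum>i\<in>UNIV. x $ i * v $ i) + (Xtilde j - x) $ last_ix * (\<Sum>i\<in>UNIV. v $ i)"
    unfolding inner_vec_def inner_real_def sum_distrib_left sum.distrib[symmetric]
    by (metis (no_types, lifting) distrib_right)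
  also have "\<dots> = (\<Sum>i\<in>UNIV. if j < i then v $ i else 0)"
    unfolding v by (simp add: x_def if_distrib[where f="\<lambda>u. u * _"] cong: if_cong)
  also have "\<dots> = (\<Sum>i\<in>{j<..}. v $ i)"
    by (simp add: sum.If_cases greaterThan_def)
  finally show ?thesis .
qed

lemma span_Xtilde_jump:
  fixes v :: "real^'n::{finite,wellorder}"
  assumes "v \<in> span (Xtilde ` A)" "A \<subseteq> diff_ix" "l \<in> diff_ix - A"
  shows "v $ next_ix l = v $ l"
proof -
  have "subspace {v::real^'n::_. v $ next_ix l = v $ l}"
    by (auto simp: subspace_def)
  moreover have "Xtilde ` A \<subseteq> {v. v $ next_ix l = v $ l}"
  proof (intro image_subsetI CollectI)
    fix a assume "a \<in> A"
    then have "Xtilde a $ next_ix l - Xtilde a $ l = 0"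
      using jump_Xtilde[of l a] assms by (metis DiffD1 DiffD2 subsetD)
    then show "Xtilde a $ next_ix l = Xtilde a $ l" by simp
  qed
  ultimately have "span (Xtilde ` A) \<subseteq> {v. v $ next_ix l = v $ l}"
    by (rule span_minimal[rotated])
  then show ?thesis using assms by auto
qed

lemma span_Xtilde_sum:
  fixes v :: "real^'n::{finite,wellorder}"
  assumes "v \<in> span (Xtilde ` A)" "A \<subseteq> diff_ix"
  shows "(\<Sum>i\<in>UNIV. v $ i) = 0"
proof -
  have "subspace {v::real^'n::_. (\<Sum>i\<in>UNIV. v $ i) = 0}"
    by (auto simp: subspace_def sum.distrib sum_distrib_left[symmetric])
  moreover have "Xtilde ` A \<subseteq> {v. (\<Sum>i\<in>UNIV. v $ i) = 0}"
    using sum_Xtilde assms by fastforce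
  ultimately have "span (Xtilde ` A) \<subseteq> {v. (\<Sum>i\<in>UNIV. v $ i) = 0}"
    by (rule span_minimal[rotated])
  then show ?thesis using assms by auto
qed

lemma Xtilde_not_in_span:
  assumes "j \<in> diff_ix" "A \<subseteq> diff_ix - {j}"
  shows "Xtilde j \<notin> span (Xtilde ` A)"
proof
  assume "Xtilde j \<in> span (Xtilde ` A)"
  then have "Xtilde j $ next_ix j = Xtilde j $ j"
    by (rule span_Xtilde_jump) (use assms in auto)
  then show False using jump_Xtilde[of j j] assms by simp
qed

text \<open>
  With \<open>g i\<close> the sum of \<open>v\<close> from coordinate \<open>i\<close> on, the correlations are the values of \<open>g\<close>, and \<open>v\<close>
  is the negative increment of \<open>g\<close>.  At the last point where \<open>g\<close> attains a maximum above \<open>c\<close> there is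
  no jump of \<open>v\<close>, so \<open>g\<close> has equal increments on both sides; the left one is at least \<open>0\<close>
  and the right one is negative.
\<close>

lemma Xtilde_maximum_principle:
  fixes v :: "real^'n::{finite,wellorder}"
  assumes v: "v \<in> span (Xtilde ` A)" and A: "A \<subseteq> diff_ix"
    and le: "\<And>a. a \<in> A \<Longrightarrow> Xtilde a \<bullet> v \<le> c" and c: "0 \<le> c"
    and j: "j \<in> diff_ix"
  shows "Xtilde j \<bullet> v \<le> c"
proof (rule ccontr)
  assume neg: "\<not> Xtilde j \<bullet> v \<le> c"
  define g where "g i = (\<Sum>l\<in>{i..}. v $ l)" for i
  have sum0: "(\<Sum>i\<in>UNIV. v $ i) = 0" by (rule span_Xtilde_sum[OF v A])
  have inner_g: "Xtilde l \<bullet> v = g (next_ix l)" if "l \<in> diff_ix" for l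
    using that by (simp add: Xtilde_inner[OF that sum0] g_def greaterThan_eq_next_ix)
  have g_rec: "g i = v $ i + (\<Sum>l\<in>{i<..}. v $ l)" for i
  proof -
    have "{i..} = insert i {i<..}" by auto
    then show ?thesis by (simp add: g_def)
  qed
  define m where "m = Max (range g)"
  have g_le: "g i \<le> m" for i by (simp add: m_def)
  have m_gt: "c < m" using neg g_le[of "next_ix j"] by (simp add: inner_g[OF j])
  define i where "i = Max {i. g i = m}"
  have "m \<in> range g" unfolding m_def by (rule Max_in) auto
  then have "i \<in> {i. g i = m}" unfolding i_def by (intro Max_in) auto
  then have gi: "g i = m" by simp
  have i_max: "l \<le> i" if "g l = m" for l
    unfolding i_def by (rule Max_ge) (use that in auto)
  have "\<exists>l. l < i"
  proof (rule ccontr)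
    assume "\<nexists>l. l < i"
    then have "{i..} = UNIV" by (auto simp: not_less)
    then have "g i = 0" by (simp add: g_def sum0)
    then show False using gi m_gt c by simp
  qed
  then obtain p where p: "p \<in> diff_ix" "next_ix p = i" using next_ix_surj by blast
  have "p \<notin> A" using le[of p] inner_g[OF p(1)] p gi m_gt by auto
  then have vp: "v $ i = v $ p" using span_Xtilde_jump[OF v A, of p] p by auto
  have "g p = v $ p + g i"
    unfolding g_rec[of p] greaterThan_eq_next_ix[OF p(1)] p(2) by (simp add: g_def)
  then have "v $ i \<le> 0" using g_le[of p] gi vp by simp
  then have tail: "m \<le> (\<Sum>l\<in>{i<..}. v $ l)" using g_rec[of i] gi by simp
  show False
  proof (cases "i = last_ix")
    case True
    then have "{i<..} = {}" using le_last_ix by (auto simp: not_less[symmetric])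
    then show False using tail m_gt c by simp
  next
    case False
    then have id: "i \<in> diff_ix" by (simp add: diff_ix_iff)
    have "m \<le> g (next_ix i)" using tail by (simp add: g_def greaterThan_eq_next_ix[OF id])
    then have "next_ix i \<le> i" using g_le[of "next_ix i"] i_max by auto
    then show False using less_next_ix[OF id] by simp
  qed
qed

lemma Xtilde_abs_maximum_principle:
  fixes v :: "real^'n::{finite,wellorder}"
  assumes v: "v \<in> span (Xtilde ` A)" and A: "A \<subseteq> diff_ix"
    and le: "\<And>a. a \<in> A \<Longrightarrow> \<bar>Xtilde a \<bullet> v\<bar> \<le> c" and c: "0 \<le> c"
    and j: "j \<in> diff_ix"
  shows "\<bar>Xtilde j \<bullet> v\<bar> \<le> c"
proof -
  have "Xtilde j \<bullet> v \<le> c"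
    by (rule Xtilde_maximum_principle[OF v A _ c j]) (use le in \<open>auto simp: abs_le_iff\<close>)
  moreover have "Xtilde j \<bullet> (- v) \<le> c"
    by (rule Xtilde_maximum_principle[OF span_neg[OF v] A _ c j]) (use le in \<open>auto simp: abs_le_iff\<close>)
  ultimately show ?thesis by (simp add: abs_le_iff)
qed

lemma span_Xtilde_inner_ytilde:
  fixes u :: "real^'n::{finite,wellorder}"
  assumes "u \<in> span (Xtilde ` diff_ix)"
  shows "u \<bullet> ytilde v = u \<bullet> v"
proof -
  have "orthogonal (ytilde v - v) u"
  proof (rule orthogonal_to_span[OF assms])
    fix x assume "x \<in> Xtilde ` (diff_ix :: 'n set)"
    then show "orthogonal (ytilde v - v) x"
      using Xtilde_inner_ytilde[of _ v] by (auto simp: orthogonal_def inner_diff_left inner_diff_right inner_commute)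
  qed
  then show ?thesis by (simp add: orthogonal_def inner_diff_left inner_diff_right inner_commute)
qed

lemma borel_measurable_ytilde: "ytilde \<in> borel_measurable (borel :: (real^'n::{finite,wellorder}) measure)"
  unfolding ytilde_def by (intro borel_measurable_continuous_onI matrix_vector_mult_linear_continuous_on)

section \<open>Least squares on linearly independent columns\<close>

locale indep_family =
  fixes X :: "'i \<Rightarrow> 'v::euclidean_space" and J :: "'i set"
  assumes finite_J: "finite J"
    and indep: "\<And>j A. j \<in> J \<Longrightarrow> A \<subseteq> J - {j} \<Longrightarrow> X j \<notin> span (X ` A)"
begin

lemma inj_on_X: "inj_on X J"
proof (rule inj_onI, rule ccontr)
  fix a b assume ab: "a \<in> J" "b \<in> J" "X a = X b" "a \<noteq> b"
  then have "X a \<notin> span (X ` {b})" by (intro indep) auto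
  then show False using ab by (simp add: span_base)
qed

lemma span_X_sum:
  assumes "A \<subseteq> J" "v \<in> span (X ` A)"
  obtains h where "v = (\<Sum>a\<in>A. h a *\<^sub>R X a)"
proof -
  have fin: "finite A" using assms finite_J finite_subset by blast
  obtain u where "v = (\<Sum>x\<in>X ` A. u x *\<^sub>R x)"
    using assms(2) span_finite[of "X ` A"] fin by auto
  also have "\<dots> = (\<Sum>a\<in>A. u (X a) *\<^sub>R X a)"
    by (subst sum.reindex) (use inj_on_X assms(1) inj_on_subset in \<open>auto simp: o_def\<close>)
  finally show ?thesis by (rule that)
qed

text \<open>
  Subtract from \<open>X c\<close> its projection on the other columns and normalize.  The coefficients of these
  vectors form the inverse of the Gram matrix.
\<close>

lemma dual_vector:
  assumes A: "A \<subseteq> J" and c: "c \<in> A"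
  shows "\<exists>u\<in>span (X ` A). \<forall>a\<in>A. X a \<bullet> u = (if a = c then 1 else 0)"
proof -
  obtain p q where p: "p \<in> span (X ` (A - {c}))" and q: "\<And>w. w \<in> span (X ` (A - {c})) \<Longrightarrow> orthogonal q w"
    and e: "X c = p + q"
    using orthogonal_subspace_decomp_exists[of "X ` (A - {c})" "X c"] by metis
  have "X c \<notin> span (X ` (A - {c}))" by (rule indep) (use A c in auto)
  then have q0: "q \<noteq> 0" using p e by auto
  have "span (X ` (A - {c})) \<subseteq> span (X ` A)" by (intro span_mono image_mono) auto
  then have "X c - p \<in> span (X ` A)"
    using p c by (intro span_diff) (auto intro: span_base)
  then have qs: "q \<in> span (X ` A)" using e by simp
  have "X c \<bullet> q = q \<bullet> q"
    using q[OF p] by (simp add: e inner_add_left inner_add_right orthogonal_def inner_commute)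
  moreover have "X a \<bullet> q = 0" if "a \<in> A" "a \<noteq> c" for a
    using q[of "X a"] that by (auto simp: orthogonal_def inner_commute intro: span_base)
  ultimately show ?thesis
    using q0 qs by (intro bexI[of _ "q /\<^sub>R (q \<bullet> q)"]) (auto intro: span_scale)
qed

text \<open>
  The Gram matrix of the dual vectors is both a right and, by symmetry, a left inverse, so the choice
  in \<open>inv_on\<close> is made from a nonempty set.
\<close>

lemma gram_inverse:
  assumes A: "A \<subseteq> J" and ac: "a \<in> A" "c \<in> A"
  shows "(\<Sum>b\<in>A. (X a \<bullet> X b) * inv_on A (\<lambda>i j. X i \<bullet> X j) b c) = (if a = c then 1 else 0)"
proof -
  obtain u where us: "\<And>c. c \<in> A \<Longrightarrow> u c \<in> span (X ` A)"
    and u: "\<And>a c. a \<in> A \<Longrightarrow> c \<in> A \<Longrightarrow> X a \<bullet> u c = (if a = c then 1 else 0)"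
    using dual_vector[OF A] by metis
  have "\<exists>h. u c = (\<Sum>b\<in>A. h b *\<^sub>R X b)" if "c \<in> A" for c
    using span_X_sum[OF A us[OF that]] by metis
  then obtain h where h: "\<And>c. c \<in> A \<Longrightarrow> u c = (\<Sum>b\<in>A. h c b *\<^sub>R X b)" by metis
  define H where "H b c = h c b" for b c
  have right: "(\<Sum>b\<in>A. (X a \<bullet> X b) * H b c) = (if a = c then 1 else 0)" if "a \<in> A" "c \<in> A" for a c
    using u[OF that] by (simp add: h[OF that(2)] inner_sum_right H_def mult.commute)
  have gram: "u a \<bullet> u c = H a c" if "a \<in> A" "c \<in> A" for a c
  proof -
    have "u a \<bullet> u c = (\<Sum>b\<in>A. h c b * (X b \<bullet> u a))"
      by (simp add: h[OF that(2)] inner_sum_right inner_commute)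
    also have "\<dots> = (\<Sum>b\<in>A. if b = a then h c b else 0)"
      by (rule sum.cong) (simp_all add: u that)
    finally show ?thesis
      using that finite_subset[OF A finite_J] by (simp add: H_def)
  qed
  have left: "(\<Sum>b\<in>A. H a b * (X b \<bullet> X c)) = (if a = c then 1 else 0)" if "a \<in> A" "c \<in> A" for a c
  proof -
    have "(\<Sum>b\<in>A. H a b * (X b \<bullet> X c)) = (\<Sum>b\<in>A. (X c \<bullet> X b) * H b a)"
      by (rule sum.cong) (use gram that in \<open>metis inner_commute mult.commute\<close>)+
    then show ?thesis using right[of c a] that by auto
  qed
  have "\<forall>a\<in>A. \<forall>c\<in>A.
      (\<Sum>b\<in>A. (X a \<bullet> X b) * inv_on A (\<lambda>i j. X i \<bullet> X j) b c) = (if a = c then 1 else 0) \<and>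
      (\<Sum>b\<in>A. inv_on A (\<lambda>i j. X i \<bullet> X j) a b * (X b \<bullet> X c)) = (if a = c then 1 else 0)"
    unfolding inv_on_def by (rule someI[of _ H]) (use right left in blast)
  then show ?thesis using ac by blast
qed

lemma inner_lsq:
  assumes A: "A \<subseteq> J" and a: "a \<in> A"
  shows "X a \<bullet> lsq X A w = w a"
proof -
  let ?H = "inv_on A (\<lambda>i j. X i \<bullet> X j)"
  have "X a \<bullet> lsq X A w = (\<Sum>b\<in>A. \<Sum>c\<in>A. w c * ((X a \<bullet> X b) * ?H b c))"
    by (simp add: lsq_def inner_sum_right sum_distrib_right sum_distrib_left ac_simps)
  also have "\<dots> = (\<Sum>c\<in>A. w c * (\<Sum>b\<in>A. (X a \<bullet> X b) * ?H b c))"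
    unfolding sum_distrib_left by (rule sum.swap)
  also have "\<dots> = (\<Sum>c\<in>A. w c * (if a = c then 1 else 0))"
    by (rule sum.cong) (simp_all add: gram_inverse[OF A a])
  also have "\<dots> = w a"
    using a finite_subset[OF A finite_J] by (simp add: if_distrib[where f="\<lambda>u. _ * u"] cong: if_cong)
  finally show ?thesis .
qed

lemma span_X_eq:
  assumes "A \<subseteq> J" "v - w \<in> span (X ` A)"
    and eq: "\<And>a. a \<in> A \<Longrightarrow> X a \<bullet> v = X a \<bullet> w"
  shows "v = w"
proof -
  have "orthogonal (v - w) (v - w)"
  proof (rule orthogonal_to_span[OF assms(2)])
    fix x assume "x \<in> X ` A"
    then show "orthogonal (v - w) x"
      using eq by (auto simp: orthogonal_def inner_diff_left inner_diff_right inner_commute)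
  qed
  then show ?thesis by (simp add: orthogonal_def)
qed

end

lemma lsq_in_span: "lsq X A w \<in> span (X ` A)"
  unfolding lsq_def by (intro span_sum span_scale span_base) auto

lemma lsq_diff: "lsq X A (\<lambda>a. u a - l * w a) = lsq X A u - l *\<^sub>R lsq X A w"
  by (simp add: lsq_def algebra_simps sum_subtractf sum_distrib_left
      scaleR_sum_right)

context indep_family
begin

lemma inner_proj_on:
  assumes "A \<subseteq> J" "u \<in> span (X ` A)"
  shows "u \<bullet> proj_on X A v = u \<bullet> v"
proof -
  have "orthogonal (proj_on X A v - v) u"
  proof (rule orthogonal_to_span[OF assms(2)])
    fix x assume "x \<in> X ` A"
    then show "orthogonal (proj_on X A v - v) x"
      using inner_lsq[OF assms(1)] by (auto simp: proj_on_def orthogonal_def inner_diff_left inner_diff_right inner_commute)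
  qed
  then show ?thesis by (simp add: orthogonal_def inner_diff_left inner_diff_right inner_commute)
qed

lemma proj_on_self_adjoint:
  assumes "A \<subseteq> J"
  shows "u \<bullet> proj_on X A v = proj_on X A u \<bullet> v"
proof -
  have "proj_on X A v \<bullet> proj_on X A u = proj_on X A v \<bullet> u"
    by (rule inner_proj_on[OF assms]) (simp add: proj_on_def lsq_in_span)
  moreover have "proj_on X A u \<bullet> proj_on X A v = proj_on X A u \<bullet> v"
    by (rule inner_proj_on[OF assms]) (simp add: proj_on_def lsq_in_span)
  ultimately show ?thesis by (simp add: inner_commute)
qed

end

section \<open>LARS paths without leaving variables\<close>

lemma active_take_Suc:
  "i < length es \<Longrightarrow> active (take (Suc i) es) = insert (fst (es ! i)) (active (take i es))"
  by (simp add: active_def take_Suc_conv_app_nth)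

lemma distinct_map_take: "distinct (map fst es) \<Longrightarrow> distinct (map fst (take i es))"
  by (simp add: take_map[symmetric])

lemma sign_of_nth:
  assumes "distinct (map fst es)" "i < length es"
  shows "sign_of es (fst (es ! i)) = snd (es ! i)"
proof -
  have "map_of es (fst (es ! i)) = Some (snd (es ! i))"
    using assms by (simp add: map_of_eq_Some_iff)
  then show ?thesis by (simp add: sign_of_def)
qed

text \<open>
  The additional assumption is an irrepresentability condition with a weak inequality: the regression
  of an inactive column on active ones never predicts a correlation beyond the active ones.  The value \<open>1\<close> itself
  cannot be excluded: between two active jumps of equal sign the fused lasso attains it.
\<close>

locale lars_design = indep_family X J for X :: "'i \<Rightarrow> 'v::euclidean_space" and J +
  assumes irrepresentable: "\<And>A w j. A \<subseteq> J \<Longrightarrow> w \<in> span (X ` A) \<Longrightarrow>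
    (\<And>a. a \<in> A \<Longrightarrow> \<bar>X a \<bullet> w\<bar> \<le> 1) \<Longrightarrow> j \<in> J \<Longrightarrow> \<bar>X j \<bullet> w\<bar> \<le> 1"
begin

text \<open>
  Along a segment of the path the correlation of column \<open>j\<close> with the residual at \<open>l\<close> is affine in \<open>l\<close>;
  \<open>level\<close> is its value at \<open>0\<close>.
\<close>

definition slope :: "('i \<times> real) list \<Rightarrow> 'i \<Rightarrow> real" where
  "slope es j = X j \<bullet> lsq X (active es) (sign_of es)"

definition level :: "('i \<times> real) list \<Rightarrow> 'v \<Rightarrow> 'i \<Rightarrow> real" where
  "level es v j = (X j - proj_on X (active es) (X j)) \<bullet> v"

text \<open>
  The inner product of the \<open>i\<close>-th entry direction with \<open>v\<close>; it is a knot on the selection event but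
  is defined, and linear, for all \<open>v\<close>.
\<close>

definition entry_value :: "('i \<times> real) list \<Rightarrow> nat \<Rightarrow> 'v \<Rightarrow> real" where
  "entry_value es i v = lars_c X (take i es) (fst (es ! i)) (snd (es ! i)) \<bullet> v"

definition signed_path :: "('i \<times> real) list \<Rightarrow> bool" where
  "signed_path es \<longleftrightarrow> distinct (map fst es) \<and> fst ` set es \<subseteq> J \<and>
     (\<forall>i<length es. snd (es ! i) \<in> {-1, 1} \<and> snd (es ! i) \<noteq> slope (take i es) (fst (es ! i)))"

lemma lars_resid_eq:
  "lars_resid X v es l = (v - proj_on X (active es) v) + l *\<^sub>R lsq X (active es) (sign_of es)"
  by (simp add: lars_resid_def lsq_diff proj_on_def)

lemma inner_resid:
  assumes "active es \<subseteq> J"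
  shows "X j \<bullet> lars_resid X v es l = level es v j + l * slope es j"
  by (simp add: lars_resid_eq level_def slope_def inner_add_right inner_diff_right inner_diff_left
      proj_on_self_adjoint[OF assms])

lemma entry_value_eq:
  "entry_value es i v = level (take i es) v (fst (es ! i)) /
     (snd (es ! i) - slope (take i es) (fst (es ! i)))"
  by (simp add: entry_value_def lars_c_def level_def slope_def divide_inverse mult.commute)

lemma entry_value_iff:
  assumes "snd (es ! i) \<noteq> slope (take i es) (fst (es ! i))" "active (take i es) \<subseteq> J"
  shows "X (fst (es ! i)) \<bullet> lars_resid X v (take i es) l = snd (es ! i) * l \<longleftrightarrow> l = entry_value es i v"
  using assms by (auto simp: inner_resid entry_value_eq field_simps)

lemma inner_resid_active:
  assumes "active es \<subseteq> J" "a \<in> active es"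
  shows "X a \<bullet> lars_resid X v es l = l * sign_of es a"
  using inner_lsq[OF assms] by (simp add: lars_resid_def inner_diff_right)

lemma active_take_subset: "fst ` set es \<subseteq> J \<Longrightarrow> active (take i es) \<subseteq> J"
  unfolding active_def using set_take_subset[of i es] by blast

lemma signed_pathD:
  assumes "signed_path es"
  shows "distinct (map fst es)" "active (take i es) \<subseteq> J"
    "i < length es \<Longrightarrow> snd (es ! i) \<in> {-1, 1}"
    "i < length es \<Longrightarrow> snd (es ! i) \<noteq> slope (take i es) (fst (es ! i))"
  using assms active_take_subset unfolding signed_path_def by auto

lemma not_active_take:
  assumes "distinct (map fst es)" "i < length es"
  shows "fst (es ! i) \<notin> active (take i es)"
proof
  assume "fst (es ! i) \<in> active (take i es)"
  then obtain m where "m < i" "fst (es ! i) = fst (es ! m)"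
    using assms(2) by (fastforce simp: active_def in_set_conv_nth)
  then show False using assms nth_eq_iff_index_eq[OF assms(1), of i m] by simp
qed

text \<open>
  Both residuals are \<open>v\<close> minus a vector in the span of the enlarged active set, and they have the same
  correlations with it.
\<close>

lemma resid_continuous:
  assumes d: "distinct (map fst es)" and J: "fst ` set es \<subseteq> J" and i: "i < length es"
    and hit: "X (fst (es ! i)) \<bullet> lars_resid X v (take i es) l = snd (es ! i) * l"
  shows "lars_resid X v (take i es) l = lars_resid X v (take (Suc i) es) l"
proof (rule span_X_eq)
  let ?A = "active (take i es)" and ?B = "active (take (Suc i) es)"
  show B: "?B \<subseteq> J" by (rule active_take_subset[OF J])
  have A: "?A \<subseteq> J" by (rule active_take_subset[OF J])
  have AB: "?A \<subseteq> ?B" by (auto simp: active_take_Suc[OF i])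
  have "lsq X ?A w \<in> span (X ` ?B)" for w
    using lsq_in_span[of X ?A w] span_mono[OF image_mono[OF AB]] by blast
  then show "lars_resid X v (take i es) l - lars_resid X v (take (Suc i) es) l \<in> span (X ` ?B)"
    unfolding lars_resid_def by (simp add: algebra_simps span_diff lsq_in_span)
  fix a assume a: "a \<in> ?B"
  have dS: "distinct (map fst (take (Suc i) es))" by (rule distinct_map_take[OF d])
  have di: "distinct (map fst (take i es))" by (rule distinct_map_take[OF d])
  show "X a \<bullet> lars_resid X v (take i es) l = X a \<bullet> lars_resid X v (take (Suc i) es) l"
  proof (cases "a = fst (es ! i)")
    case True
    have "sign_of (take (Suc i) es) a = snd (es ! i)"
      using sign_of_nth[OF dS, of i] i True by simp
    then show ?thesis using hit True inner_resid_active[OF B a, of v l] by simp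
  next
    case False
    then have aA: "a \<in> ?A" using a by (simp add: active_take_Suc[OF i])
    then obtain m where m: "m < i" "m < length es" "a = fst (es ! m)"
      by (fastforce simp: active_def in_set_conv_nth)
    have "sign_of (take (Suc i) es) a = snd (es ! m)" "sign_of (take i es) a = snd (es ! m)"
      using sign_of_nth[OF dS, of m] sign_of_nth[OF di, of m] m by simp_all
    then show ?thesis by (simp add: inner_resid_active[OF B a] inner_resid_active[OF A aA])
  qed
qed

lemma slope_le_1:
  assumes d: "distinct (map fst es)" and J: "fst ` set es \<subseteq> J"
    and s: "\<And>i. i < length es \<Longrightarrow> \<bar>snd (es ! i)\<bar> \<le> 1" and j: "j \<in> J"
  shows "\<bar>slope es j\<bar> \<le> 1"
  unfolding slope_def
proof (rule irrepresentable[of "active es"])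
  show A: "active es \<subseteq> J" using J by (simp add: active_def)
  show "lsq X (active es) (sign_of es) \<in> span (X ` active es)" by (rule lsq_in_span)
  fix a assume a: "a \<in> active es"
  then obtain m where "m < length es" "a = fst (es ! m)"
    by (auto simp: active_def in_set_conv_nth)
  then show "\<bar>X a \<bullet> lsq X (active es) (sign_of es)\<bar> \<le> 1"
    using s sign_of_nth[OF d, of m] inner_lsq[OF A a] by simp
qed (rule j)

lemma slope_take_le_1:
  assumes "signed_path es" "j \<in> J"
  shows "\<bar>slope (take i es) j\<bar> \<le> 1"
proof (rule slope_le_1)
  show "distinct (map fst (take i es))"
    by (intro distinct_map_take signed_pathD(1)[OF assms(1)])
  show "fst ` set (take i es) \<subseteq> J"
    using signed_pathD(2)[OF assms(1), of i] by (simp add: active_def)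
  fix m assume "m < length (take i es)"
  then show "\<bar>snd (take i es ! m)\<bar> \<le> 1"
    using signed_pathD(3)[OF assms(1), of m] by auto
qed (rule assms)

text \<open>
  When \<open>l\<close> grows to \<open>l'\<close> the correlation changes by at most \<open>l' - l\<close>.  This is the reason why
  no earlier competition restricts the response beyond the last one.
\<close>

lemma gap_mono:
  assumes path: "signed_path es" and j: "j \<in> J" and l: "l \<le> l'"
    and gap: "\<bar>X j \<bullet> lars_resid X v (take i es) l\<bar> < l"
  shows "\<bar>X j \<bullet> lars_resid X v (take i es) l'\<bar> < l'"
proof -
  have A: "active (take i es) \<subseteq> J" by (rule signed_pathD(2)[OF path])
  have "\<bar>(l' - l) * slope (take i es) j\<bar> \<le> l' - l"
    using slope_take_le_1[OF path j, of i] l by (simp add: abs_mult mult_left_le)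
  moreover have "X j \<bullet> lars_resid X v (take i es) l' =
      X j \<bullet> lars_resid X v (take i es) l + (l' - l) * slope (take i es) j"
    by (simp add: inner_resid[OF A] algebra_simps)
  ultimately show ?thesis using gap by linarith
qed

text \<open>
  The entrant attains the bound with equality at its entry, so \<open>gap_mono\<close> does not apply to it.  Strictness before
  the entry comes from the slope being different from its sign; if the slope is the opposite sign,
  the positivity of the entry value is needed as well.
\<close>

lemma gap_before_entry:
  assumes path: "signed_path es" and i: "i < length es"
    and h: "0 < entry_value es i v" and l: "entry_value es i v < l"
  shows "\<bar>X (fst (es ! i)) \<bullet> lars_resid X v (take i es) l\<bar> < l"
proof -
  let ?h = "entry_value es i v" and ?j = "fst (es ! i)" and ?s = "snd (es ! i)"
  let ?b = "slope (take i es) ?j"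
  have A: "active (take i es) \<subseteq> J" by (rule signed_pathD(2)[OF path])
  have s: "?s = -1 \<or> ?s = 1" and sb: "?s \<noteq> ?b" using signed_pathD(3,4)[OF path i] by auto
  have "?j \<in> J" using path i by (auto simp: signed_path_def)
  then have b: "\<bar>?b\<bar> \<le> 1" by (rule slope_take_le_1[OF path])
  have "X ?j \<bullet> lars_resid X v (take i es) ?h = ?s * ?h"
    using entry_value_iff[OF sb A] by blast
  then have e: "X ?j \<bullet> lars_resid X v (take i es) l = ?s * ?h + (l - ?h) * ?b"
    by (simp add: inner_resid[OF A] algebra_simps)
  have sbl: "(l - ?h) * (?s * ?b) < l - ?h" "- (l - ?h) \<le> (l - ?h) * (?s * ?b)"
  proof -
    have "?s * ?b < 1" "-1 \<le> ?s * ?b" using s sb b by (auto simp: abs_le_iff)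
    then show "(l - ?h) * (?s * ?b) < l - ?h" "- (l - ?h) \<le> (l - ?h) * (?s * ?b)"
      using l mult_strict_left_mono[of "?s * ?b" 1 "l - ?h"] mult_left_mono[of "-1" "?s * ?b" "l - ?h"]
      by simp_all
  qed
  have "?s * (?s * ?h + (l - ?h) * ?b) = ?h + (l - ?h) * (?s * ?b)"
    using s by (auto simp: algebra_simps)
  then have "\<bar>?s * (?s * ?h + (l - ?h) * ?b)\<bar> < l"
    using sbl h l by (simp only: abs_less_iff) linarith
  then show ?thesis using s unfolding e by (auto simp: abs_mult)
qed


lemma reaches_path:
  assumes "lars_reaches X J v es"
  shows "distinct (map fst es)" "fst ` set es \<subseteq> J"
proof -
  have *: "fst (es ! i) \<in> J - active (take i es)" if "i < length es" for i
    using assms that by (auto simp: lars_reaches_def Let_def split_beta)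
  show "fst ` set es \<subseteq> J" using * by (metis DiffD1 image_subsetI in_set_conv_nth)
  have ne: "fst (es ! m) \<noteq> fst (es ! i)" if "m < i" "i < length es" for m i
  proof -
    have "es ! m \<in> set (take i es)" using that by (auto simp: in_set_conv_nth)
    then show ?thesis using *[OF that(2)] unfolding active_def by (metis DiffD2 image_eqI)
  qed
  show "distinct (map fst es)"
    unfolding distinct_conv_nth using ne by (metis length_map linorder_neqE_nat nth_map)
qed

lemma Greatest_has_greatest:
  fixes S :: "real set"
  assumes "has_greatest S"
  shows "(GREATEST l. l \<in> S) \<in> S" "\<And>x. x \<in> S \<Longrightarrow> x \<le> (GREATEST l. l \<in> S)"
proof -
  obtain m where m: "m \<in> S" "\<And>x. x \<in> S \<Longrightarrow> x \<le> m" using assms by (auto simp: has_greatest_def)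
  then have "(GREATEST l. l \<in> S) = m" by (intro Greatest_equality) auto
  then show "(GREATEST l. l \<in> S) \<in> S" "\<And>x. x \<in> S \<Longrightarrow> x \<le> (GREATEST l. l \<in> S)" using m by auto
qed


text \<open>
  The entrant attains the largest absolute correlation among the inactive columns; by general
  position it is the only one to do so, so that the others stay strictly below.
\<close>

lemma reaches_entry:
  assumes reach: "lars_reaches X J v es" and gen: "lars_generic X J v" and i: "i < length es"
    and knot: "lars_knot X J v es (Suc i) = ereal h"
    and le: "\<And>j. j \<in> J - active (take i es) \<Longrightarrow> \<bar>X j \<bullet> lars_resid X v (take i es) h\<bar> \<le> h"
  shows "\<bar>X (fst (es ! i)) \<bullet> lars_resid X v (take i es) h\<bar> = h"
    "snd (es ! i) = sgn (X (fst (es ! i)) \<bullet> lars_resid X v (take i es) h)"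
    "X (fst (es ! i)) \<bullet> lars_resid X v (take i es) h = snd (es ! i) * h"
    "j \<in> J - active (take (Suc i) es) \<Longrightarrow> \<bar>X j \<bullet> lars_resid X v (take (Suc i) es) h\<bar> < h"
proof -
  let ?j = "fst (es ! i)" and ?r = "lars_resid X v (take i es) h"
  have er: "entry_resid X J v es i = ?r" by (simp add: entry_resid_def knot)
  have "?j \<in> J - active (take i es) \<and> ereal \<bar>X ?j \<bullet> entry_resid X J v es i\<bar> = lars_knot X J v es (Suc i) \<and>
      snd (es ! i) = sgn (X ?j \<bullet> entry_resid X J v es i)"
    using reach i unfolding lars_reaches_def Let_def split_beta by blast
  then have j: "?j \<in> J - active (take i es)" and abs: "\<bar>X ?j \<bullet> ?r\<bar> = h" and sgn: "snd (es ! i) = sgn (X ?j \<bullet> ?r)"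
    unfolding er knot by auto
  show "\<bar>X ?j \<bullet> ?r\<bar> = h" "snd (es ! i) = sgn (X ?j \<bullet> ?r)" by fact+
  show hit: "X ?j \<bullet> ?r = snd (es ! i) * h"
    using abs sgn by (metis mult_sgn_abs)
  assume "j \<in> J - active (take (Suc i) es)"
  then have jj: "j \<in> J - active (take i es)" "j \<noteq> ?j" by (auto simp: active_take_Suc[OF i])
  have uniq: "\<exists>!j. is_arg_max (\<lambda>j. \<bar>X j \<bullet> ?r\<bar>) (\<lambda>j. j \<in> J - active (take i es)) j"
    using gen reach i unfolding lars_generic_def er[symmetric] by blast
  have "is_arg_max (\<lambda>j. \<bar>X j \<bullet> ?r\<bar>) (\<lambda>j. j \<in> J - active (take i es)) ?j"
    using le j abs by (auto simp: is_arg_max_linorder)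
  then have "\<not> is_arg_max (\<lambda>j. \<bar>X j \<bullet> ?r\<bar>) (\<lambda>j. j \<in> J - active (take i es)) j"
    using uniq jj(2) by blast
  then have "\<bar>X j \<bullet> ?r\<bar> \<noteq> h" using jj(1) le by (auto simp: is_arg_max_linorder)
  then have "\<bar>X j \<bullet> ?r\<bar> < h" using le[OF jj(1)] by simp
  then show "\<bar>X j \<bullet> lars_resid X v (take (Suc i) es) h\<bar> < h"
    using resid_continuous[OF reaches_path[OF reach] i hit] by simp
qed

text \<open>
  An inactive column is strictly below the bound at a knot.  If it were above the bound at the next
  knot, it would have met the bound in between, at a crossing larger than the greatest one.
\<close>

lemma reaches_gaps:
  assumes reach: "lars_reaches X J v es" and gen: "lars_generic X J v" and "i < length es"
  shows "\<exists>h. lars_knot X J v es (Suc i) = ereal h \<and> (i > 0 \<longrightarrow> ereal h < lars_knot X J v es i) \<and>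
     (\<forall>j\<in>J - active (take i es). \<bar>X j \<bullet> lars_resid X v (take i es) h\<bar> \<le> h)"
  using \<open>i < length es\<close>
proof (induction i)
  case 0
  have "finite J" by (rule finite_J)
  then show ?case
    by (auto simp: active_def lars_resid_def lsq_def)
next
  case (Suc i)
  then have i: "i < length es" by simp
  from Suc.IH[OF i] obtain h where knot: "lars_knot X J v es (Suc i) = ereal h"
    and le: "\<And>j. j \<in> J - active (take i es) \<Longrightarrow> \<bar>X j \<bullet> lars_resid X v (take i es) h\<bar> \<le> h"
    by blast
  note gap = reaches_entry(4)[OF reach gen i knot le]
  let ?es = "take (Suc i) es"
  define S where "S = lars_crossings X J v ?es (ereal h)"
  have greatest: "has_greatest S"
    using reach Suc.prems knot by (auto simp: lars_reaches_def Let_def split_beta S_def simp del: lars_knot.simps)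
  define g where "g = (GREATEST l. l \<in> S)"
  note g = Greatest_has_greatest[OF greatest, folded g_def]
  have knot': "lars_knot X J v es (Suc (Suc i)) = ereal g"
    using greatest by (simp add: knot S_def[symmetric] g_def[symmetric] Let_def)
  have gh: "g < h" using g(1) by (simp add: S_def lars_crossings_def)
  have A: "active ?es \<subseteq> J" by (rule active_take_subset[OF reaches_path(2)[OF reach]])
  have "\<bar>X j \<bullet> lars_resid X v ?es g\<bar> \<le> g" if j: "j \<in> J - active ?es" for j
  proof (rule ccontr)
    define f where "f l = \<bar>X j \<bullet> lars_resid X v ?es l\<bar> - l" for l
    assume "\<not> \<bar>X j \<bullet> lars_resid X v ?es g\<bar> \<le> g"
    then have "0 < f g" by (simp add: f_def)
    moreover have "f h < 0" using gap[OF _ j] by (simp add: f_def)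
    moreover have "continuous_on {g..h} f"
      unfolding f_def inner_resid[OF A] by (intro continuous_intros)
    ultimately obtain x where x: "g \<le> x" "x \<le> h" "f x = 0"
      using IVT2'[of f h 0 g] gh by auto
    have "x \<noteq> g" "x \<noteq> h" using x(3) \<open>0 < f g\<close> \<open>f h < 0\<close> by auto
    then have "x \<in> S" "g < x" using x j by (auto simp: S_def lars_crossings_def f_def)
    then show False using g(2)[of x] by simp
  qed
  then show ?case using knot knot' gh by (intro exI[of _ g]) auto
qed

text \<open>
  For distinct columns this fails only on finitely many hyperplanes.  It excludes entrants with sign \<open>0\<close> or with
  sign equal to the slope, for which the entry direction would be undefined.
\<close>

definition nondegenerate :: "('i \<times> real) list \<Rightarrow> 'v \<Rightarrow> bool" where
  "nondegenerate es v \<longleftrightarrow> (\<forall>i<length es. level (take i es) v (fst (es ! i)) \<noteq> 0)"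

definition entries_ordered :: "('i \<times> real) list \<Rightarrow> 'v \<Rightarrow> bool" where
  "entries_ordered es v \<longleftrightarrow>
     (\<forall>i. Suc i < length es \<longrightarrow> entry_value es (Suc i) v < entry_value es i v)"

definition last_gap :: "('i \<times> real) list \<Rightarrow> 'v \<Rightarrow> real \<Rightarrow> bool" where
  "last_gap es v h \<longleftrightarrow> 0 < h \<and> (\<forall>j\<in>J - active es. \<bar>X j \<bullet> lars_resid X v es h\<bar> < h)"

lemma reaches_signed_path:
  assumes reach: "lars_reaches X J v es" and gen: "lars_generic X J v" and nd: "nondegenerate es v"
  shows "signed_path es"
  unfolding signed_path_def
proof (intro conjI allI impI)
  note path = reaches_path[OF reach]
  fix i assume i: "i < length es"
  obtain h where knot: "lars_knot X J v es (Suc i) = ereal h"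
    and le: "\<And>j. j \<in> J - active (take i es) \<Longrightarrow> \<bar>X j \<bullet> lars_resid X v (take i es) h\<bar> \<le> h"
    using reaches_gaps[OF reach gen i] by blast
  note entry = reaches_entry[OF reach gen i knot le]
  have "level (take i es) v (fst (es ! i)) + h * slope (take i es) (fst (es ! i)) = snd (es ! i) * h"
    using entry(3) by (simp add: inner_resid[OF active_take_subset[OF path(2)]])
  moreover have "level (take i es) v (fst (es ! i)) \<noteq> 0" using nd i by (simp add: nondegenerate_def)
  ultimately have ne: "snd (es ! i) \<noteq> slope (take i es) (fst (es ! i))" and "h \<noteq> 0" by auto
  show "snd (es ! i) \<noteq> slope (take i es) (fst (es ! i))" by fact
  show "snd (es ! i) \<in> {-1, 1}"
    using entry(1,2) \<open>h \<noteq> 0\<close> by (auto simp: sgn_if split: if_splits)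
qed (use reaches_path[OF reach] in auto)

lemma reaches_knot:
  assumes reach: "lars_reaches X J v es" and gen: "lars_generic X J v" and path: "signed_path es"
    and i: "i < length es"
  shows "lars_knot X J v es (Suc i) = ereal (entry_value es i v)"
    "i > 0 \<Longrightarrow> ereal (entry_value es i v) < lars_knot X J v es i"
    "last_gap (take (Suc i) es) v (entry_value es i v)"
proof -
  obtain h where knot: "lars_knot X J v es (Suc i) = ereal h"
    and less: "i > 0 \<longrightarrow> ereal h < lars_knot X J v es i"
    and le: "\<And>j. j \<in> J - active (take i es) \<Longrightarrow> \<bar>X j \<bullet> lars_resid X v (take i es) h\<bar> \<le> h"
    using reaches_gaps[OF reach gen i] by blast
  note entry = reaches_entry[OF reach gen i knot le]
  have h: "h = entry_value es i v"
    using entry_value_iff[OF signed_pathD(4)[OF path i] signed_pathD(2)[OF path]] entry(3) by blast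
  have "0 < h"
    using entry(1,2) signed_pathD(3)[OF path i] by (auto simp: sgn_if split: if_splits)
  then show "lars_knot X J v es (Suc i) = ereal (entry_value es i v)"
    "i > 0 \<Longrightarrow> ereal (entry_value es i v) < lars_knot X J v es i"
    "last_gap (take (Suc i) es) v (entry_value es i v)"
    using knot less entry(4) by (simp_all add: h last_gap_def)
qed

text \<open>
  Backwards along the path: the condition at a knot is carried to the previous one by \<open>gap_mono\<close> for
  columns inactive throughout, and by \<open>gap_before_entry\<close> for the column that enters.
\<close>

lemma ordered_gaps:
  assumes path: "signed_path es" and ord: "entries_ordered es v"
    and gap: "last_gap es v (entry_value es n v)" and n: "length es = Suc n" and i: "i \<le> n"
  shows "last_gap (take (Suc i) es) v (entry_value es i v)"
  using i
proof (induction i rule: inc_induct)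
  case base
  then show ?case using gap n by simp
next
  case (step i)
  let ?h = "entry_value es i v" and ?h' = "entry_value es (Suc i) v" and ?es = "take (Suc i) es"
  have i: "Suc i < length es" using step n by simp
  have less: "?h' < ?h" using ord i by (simp add: entries_ordered_def)
  have pos: "0 < ?h'" using step.IH by (simp add: last_gap_def)
  have hit: "X (fst (es ! Suc i)) \<bullet> lars_resid X v ?es ?h' = snd (es ! Suc i) * ?h'"
    using entry_value_iff[OF signed_pathD(4)[OF path i] signed_pathD(2)[OF path]] by blast
  have cont: "lars_resid X v ?es ?h' = lars_resid X v (take (Suc (Suc i)) es) ?h'"
    using resid_continuous[OF _ _ i hit] path by (auto simp: signed_path_def)
  have "\<bar>X j \<bullet> lars_resid X v ?es ?h\<bar> < ?h" if j: "j \<in> J - active ?es" for j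
  proof (cases "j = fst (es ! Suc i)")
    case True
    then show ?thesis using gap_before_entry[OF path i pos less] by simp
  next
    case False
    then have "j \<in> J - active (take (Suc (Suc i)) es)"
      using j by (simp add: active_take_Suc[OF i])
    then have "\<bar>X j \<bullet> lars_resid X v ?es ?h'\<bar> < ?h'"
      using step.IH by (simp add: last_gap_def cont)
    then show ?thesis using gap_mono[OF path _ less_imp_le[OF less]] j by blast
  qed
  then show ?case using pos less by (simp add: last_gap_def)
qed

text \<open>
  By \<open>ordered_gaps\<close> no column meets the bound between consecutive entry values, so these are the greatest
  crossings.
\<close>

lemma ordered_knots:
  assumes path: "signed_path es" and ord: "entries_ordered es v"
    and gap: "last_gap es v (entry_value es n v)" and n: "length es = Suc n" and i: "i \<le> n"
  shows "lars_knot X J v es (Suc i) = ereal (entry_value es i v) \<and>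
    (i > 0 \<longrightarrow> has_greatest (lars_crossings X J v (take i es) (lars_knot X J v es i)))"
  using i
proof (induction i)
  case 0
  let ?j = "fst (es ! 0)" and ?h = "entry_value es 0 v"
  have gaps: "last_gap (take (Suc 0) es) v ?h"
    by (rule ordered_gaps[OF path ord gap n]) simp
  have r0: "lars_resid X v (take 0 es) l = v" for l by (simp add: lars_resid_def lsq_def active_def)
  have l0: "0 < length es" using n by simp
  have hit: "X ?j \<bullet> lars_resid X v (take 0 es) ?h = snd (es ! 0) * ?h"
    using entry_value_iff[OF signed_pathD(4)[OF path l0] signed_pathD(2)[OF path]] by blast
  have cont: "lars_resid X v (take (Suc 0) es) ?h = v"
    using resid_continuous[OF _ _ l0 hit] path r0 by (auto simp: signed_path_def)
  have jJ: "?j \<in> J" using path l0 by (auto simp: signed_path_def)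
  have abs: "\<bar>X ?j \<bullet> v\<bar> = ?h"
    using hit signed_pathD(3)[OF path l0] gaps unfolding r0 by (auto simp: last_gap_def)
  have "\<bar>X j \<bullet> v\<bar> \<le> ?h" if "j \<in> J" for j
  proof (cases "j = ?j")
    case False
    then have "j \<in> J - active (take (Suc 0) es)"
      using that l0 by (simp add: active_take_Suc) (simp add: active_def)
    then show ?thesis using gaps by (auto simp: last_gap_def cont intro: less_imp_le)
  qed (simp add: abs)
  then have "Max ((\<lambda>j. \<bar>X j \<bullet> v\<bar>) ` J) = ?h"
    using finite_J jJ abs by (intro Max_eqI) (auto intro: image_eqI[of _ _ ?j])
  then show ?case by simp
next
  case (Suc i)
  let ?h = "entry_value es i v" and ?h' = "entry_value es (Suc i) v" and ?es = "take (Suc i) es"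
  let ?j = "fst (es ! Suc i)"
  have i: "Suc i < length es" using Suc n by simp
  have knot: "lars_knot X J v es (Suc i) = ereal ?h" using Suc by simp
  have less: "?h' < ?h" using ord i by (simp add: entries_ordered_def)
  have gaps: "last_gap (take (Suc (Suc i)) es) v ?h'"
    by (rule ordered_gaps[OF path ord gap n]) (use Suc in simp)
  have pos: "0 < ?h'" using gaps by (simp add: last_gap_def)
  have hit: "X ?j \<bullet> lars_resid X v ?es ?h' = snd (es ! Suc i) * ?h'"
    using entry_value_iff[OF signed_pathD(4)[OF path i] signed_pathD(2)[OF path]] by blast
  have cont: "lars_resid X v ?es ?h' = lars_resid X v (take (Suc (Suc i)) es) ?h'"
    using resid_continuous[OF _ _ i hit] path by (auto simp: signed_path_def)
  define S where "S = lars_crossings X J v ?es (ereal ?h)"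
  have jJ: "?j \<in> J - active ?es"
    using path i not_active_take[OF signed_pathD(1)[OF path] i] by (auto simp: signed_path_def)
  have "\<bar>X ?j \<bullet> lars_resid X v ?es ?h'\<bar> = ?h'"
    using hit signed_pathD(3)[OF path i] pos by auto
  then have mem: "?h' \<in> S" using jJ less by (auto simp: S_def lars_crossings_def)
  have max: "l \<le> ?h'" if l: "l \<in> S" for l
  proof (rule ccontr)
    assume "\<not> l \<le> ?h'"
    then have less': "?h' < l" by simp
    obtain j where j: "j \<in> J - active ?es" "\<bar>X j \<bullet> lars_resid X v ?es l\<bar> = l"
      using l by (auto simp: S_def lars_crossings_def)
    have "\<bar>X j \<bullet> lars_resid X v ?es l\<bar> < l"
    proof (cases "j = ?j")
      case True
      then show ?thesis using gap_before_entry[OF path i pos less'] by simp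
    next
      case False
      then have "j \<in> J - active (take (Suc (Suc i)) es)"
        using j by (simp add: active_take_Suc[OF i])
      then have "\<bar>X j \<bullet> lars_resid X v ?es ?h'\<bar> < ?h'"
        using gaps by (simp add: last_gap_def cont)
      then show ?thesis using gap_mono[OF path _ less_imp_le[OF less']] j by blast
    qed
    then show False using j by simp
  qed
  have hg: "has_greatest S" using mem max by (auto simp: has_greatest_def)
  have "(GREATEST l. l \<in> S) = ?h'" by (rule Greatest_equality) (use mem max in auto)
  then show ?case
    using hg knot by (simp add: S_def[symmetric] Let_def)
qed

lemma ordered_reaches:
  assumes path: "signed_path es" and ord: "entries_ordered es v"
    and gap: "last_gap es v (entry_value es n v)" and n: "length es = Suc n"
  shows "lars_reaches X J v es"
  unfolding lars_reaches_def Let_def split_beta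
proof (intro allI impI)
  fix i assume i: "i < length es"
  then have "i \<le> n" using n by simp
  note knot = ordered_knots[OF path ord gap n \<open>i \<le> n\<close>]
  let ?h = "entry_value es i v"
  have pos: "0 < ?h"
    using ordered_gaps[OF path ord gap n \<open>i \<le> n\<close>] by (simp add: last_gap_def)
  have er: "entry_resid X J v es i = lars_resid X v (take i es) ?h"
    using knot by (simp add: entry_resid_def)
  have "X (fst (es ! i)) \<bullet> lars_resid X v (take i es) ?h = snd (es ! i) * ?h"
    using entry_value_iff[OF signed_pathD(4)[OF path i] signed_pathD(2)[OF path]] by blast
  moreover have "fst (es ! i) \<in> J - active (take i es)"
    using path i not_active_take[OF signed_pathD(1)[OF path] i] by (auto simp: signed_path_def)
  ultimately show "(0 < i \<longrightarrow> has_greatest (lars_crossings X J v (take i es) (lars_knot X J v es i))) \<and>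
     fst (es ! i) \<in> J - active (take i es) \<and>
     ereal \<bar>X (fst (es ! i)) \<bullet> entry_resid X J v es i\<bar> = lars_knot X J v es (Suc i) \<and>
     snd (es ! i) = sgn (X (fst (es ! i)) \<bullet> entry_resid X J v es i)"
    using knot pos signed_pathD(3)[OF path i] unfolding er by (auto simp: abs_mult sgn_mult)
qed

text \<open>
  Under general position the greatest crossings are known to be the entry values (\<open>reaches_knot\<close>);
  conversely, one condition at the last step controls all earlier competitions (\<open>ordered_gaps\<close>).
\<close>

lemma reaches_iff:
  assumes path: "signed_path es" and gen: "lars_generic X J v" and n: "length es = Suc n"
  shows "lars_reaches X J v es \<longleftrightarrow> entries_ordered es v \<and> last_gap es v (entry_value es n v)"
proof
  assume reach: "lars_reaches X J v es"
  have "entry_value es (Suc i) v < entry_value es i v" if "Suc i < length es" for i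
    using reaches_knot(2)[OF reach gen path that] reaches_knot(1)[OF reach gen path, of i] that by simp
  moreover have "last_gap es v (entry_value es n v)"
    using reaches_knot(3)[OF reach gen path, of n] n by simp
  ultimately show "entries_ordered es v \<and> last_gap es v (entry_value es n v)"
    by (simp add: entries_ordered_def)
qed (use ordered_reaches[OF path _ _ n] in blast)

end

section \<open>The knots as functions of the response\<close>

context lars_design
begin

text \<open>
  The value of \<open>l\<close> at which the correlation of column \<open>j\<close> equals \<open>s * l\<close>; meaningful if \<open>s\<close> differs from
  the slope.
\<close>

definition candidate :: "('i \<times> real) list \<Rightarrow> 'v \<Rightarrow> 'i \<times> real \<Rightarrow> real" where
  "candidate es v = (\<lambda>(j, s). level es v j / (s - slope es j))"

definition rivals :: "('i \<times> real) list \<Rightarrow> ('i \<times> real) set" where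
  "rivals es = (J - active es) \<times> {-1, 1}"

text \<open>
  Explicit form of the knot after \<open>es\<close> when the current knot is \<open>u\<close>.  In the degenerate case a column is at the
  bound for all \<open>l\<close>, the crossings have no greatest element, and the knot is \<open>0\<close> by convention.
\<close>

definition next_knot :: "('i \<times> real) list \<Rightarrow> 'v \<Rightarrow> ereal \<Rightarrow> real" where
  "next_knot es v u =
     (if \<exists>(j, s)\<in>rivals es. s = slope es j \<and> level es v j = 0 then 0
      else Max (insert 0 ((\<lambda>p. if snd p \<noteq> slope es (fst p) \<and> 0 \<le> candidate es v p \<and> ereal (candidate es v p) < u
                     then candidate es v p else 0) ` rivals es)))"

lemma finite_rivals: "finite (rivals es)"
  using finite_J by (simp add: rivals_def)

lemma abs_eq_iff_sign: "\<bar>x\<bar> = (l::real) \<longleftrightarrow> 0 \<le> l \<and> (\<exists>s\<in>{-1, 1}. x = s * l)"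
  by (auto simp: abs_if)

lemma crossings_eq:
  assumes A: "active es \<subseteq> J"
  shows "lars_crossings X J v es u = {l. 0 \<le> l \<and> ereal l < u \<and>
    (\<exists>p\<in>rivals es. level es v (fst p) = l * (snd p - slope es (fst p)))}"
proof -
  have "(\<exists>j\<in>J - active es. \<bar>X j \<bullet> lars_resid X v es l\<bar> = l) \<longleftrightarrow>
    0 \<le> l \<and> (\<exists>p\<in>rivals es. level es v (fst p) = l * (snd p - slope es (fst p)))" for l
    unfolding abs_eq_iff_sign inner_resid[OF A] rivals_def
    by (auto simp: algebra_simps)
  then show ?thesis by (auto simp: lars_crossings_def)
qed

lemma lars_knot_Suc_Suc:
  assumes A: "active (take (Suc i) es) \<subseteq> J"
  shows "lars_knot X J v es (Suc (Suc i)) = ereal (next_knot (take (Suc i) es) v (lars_knot X J v es (Suc i)))"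
proof -
  let ?es = "take (Suc i) es" and ?u = "lars_knot X J v es (Suc i)"
  define S where "S = lars_crossings X J v ?es ?u"
  note S = crossings_eq[OF A, of v ?u, folded S_def]
  have "(if has_greatest S then GREATEST l. l \<in> S else 0) = next_knot ?es v ?u"
  proof (cases "\<exists>(j, s)\<in>rivals ?es. s = slope ?es j \<and> level ?es v j = 0")
    case True
    then obtain p where p: "p \<in> rivals ?es" "snd p = slope ?es (fst p)" "level ?es v (fst p) = 0"
      by auto
    have "\<not> has_greatest S"
    proof
      assume "has_greatest S"
      then obtain m where m: "m \<in> S" "\<And>x. x \<in> S \<Longrightarrow> x \<le> m" by (auto simp: has_greatest_def)
      then have "ereal m < ?u" "0 \<le> m" by (auto simp: S)
      then obtain x where "ereal m < ereal x" "ereal x < ?u" using ereal_dense2 by blast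
      moreover have "x \<in> S" unfolding S
        using calculation \<open>0 \<le> m\<close> p by (intro CollectI conjI bexI[of _ p]) auto
      ultimately show False using m(2)[of x] by simp
    qed
    then show ?thesis using True by (simp add: next_knot_def)
  next
    case False
    define R where "R = insert 0 ((\<lambda>p. if snd p \<noteq> slope ?es (fst p) \<and> 0 \<le> candidate ?es v p \<and>
      ereal (candidate ?es v p) < ?u then candidate ?es v p else 0) ` rivals ?es)"
    have nk: "next_knot ?es v ?u = Max R" unfolding next_knot_def R_def using False by (simp only: if_False)
    have fin: "finite R" "R \<noteq> {}" using finite_rivals by (auto simp: R_def)
    have SR: "S \<subseteq> R"
    proof
      fix l assume "l \<in> S"
      then obtain p where l: "0 \<le> l" "ereal l < ?u" and p: "p \<in> rivals ?es"
        "level ?es v (fst p) = l * (snd p - slope ?es (fst p))"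
        by (auto simp: S)
      have "snd p \<noteq> slope ?es (fst p)" using False p by (cases p) auto
      then have "l = candidate ?es v p" using p by (simp add: candidate_def split_beta)
      then show "l \<in> R" using l p \<open>snd p \<noteq> _\<close> by (auto simp: R_def)
    qed
    have "candidate ?es v p \<in> S" if "p \<in> rivals ?es" "snd p \<noteq> slope ?es (fst p)"
        "0 \<le> candidate ?es v p" "ereal (candidate ?es v p) < ?u" for p
      unfolding S using that by (auto simp: candidate_def split_beta intro!: bexI[of _ p])
    then have RS: "R - {0} \<subseteq> S"
      unfolding R_def by (auto split: if_splits)
    show ?thesis
    proof (cases "S = {}")
      case True
      then have "R = {0}" using RS by (auto simp: R_def)
      then show ?thesis using True by (simp add: nk has_greatest_def)
    next
      case ne: False
      have max: "x \<le> Max R" if "x \<in> S" for x using that SR fin by (intro Max_ge) auto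
      have "Max R \<in> S"
      proof (cases "Max R = 0")
        case True
        obtain x where x: "x \<in> S" using ne by auto
        then have "x = 0" using max[OF x] True by (auto simp: S)
        then show ?thesis using x True by simp
      qed (use RS Max_in[OF fin] in auto)
      then have "has_greatest S" "(GREATEST l. l \<in> S) = Max R"
        using max by (auto simp: has_greatest_def intro: Greatest_equality)
      then show ?thesis by (simp add: nk)
    qed
  qed
  then show ?thesis by (auto simp: S_def[symmetric] Let_def split: if_splits)
qed

lemma borel_measurable_level: "(\<lambda>v. level es v j) \<in> borel_measurable borel"
  unfolding level_def by measurable

lemma borel_measurable_candidate: "(\<lambda>v. candidate es v p) \<in> borel_measurable borel"
  using borel_measurable_level by (simp add: candidate_def split_beta)

lemma borel_measurable_next_knot:
  assumes u [measurable]: "u \<in> borel_measurable borel"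
  shows "(\<lambda>v. next_knot es v (u v)) \<in> borel_measurable borel"
proof -
  note [measurable] = borel_measurable_level borel_measurable_candidate
  have fin: "finite (rivals es)" by (rule finite_rivals)
  have eq: "insert 0 (f ` rivals es) = (\<lambda>x. case x of None \<Rightarrow> 0 | Some p \<Rightarrow> f p) ` (insert None (Some ` rivals es))"
    for f :: "'i \<times> real \<Rightarrow> real" by (auto simp: image_image)
  have "(\<lambda>v. Max ((\<lambda>x. case x of None \<Rightarrow> 0 | Some p \<Rightarrow> (if snd p \<noteq> slope es (fst p) \<and> 0 \<le> candidate es v p \<and>
      ereal (candidate es v p) < u v then candidate es v p else 0)) ` (insert None (Some ` rivals es)))) \<in> borel_measurable borel"
  proof (rule borel_measurable_Max)
    fix x assume "x \<in> insert None (Some ` rivals es)"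
    show "(\<lambda>v. case x of None \<Rightarrow> 0 | Some p \<Rightarrow> (if snd p \<noteq> slope es (fst p) \<and> 0 \<le> candidate es v p \<and>
      ereal (candidate es v p) < u v then candidate es v p else 0)) \<in> borel_measurable borel"
      by (cases x) simp_all
  qed (use fin in auto)
  moreover have "{v. \<exists>(j, s)\<in>rivals es. s = slope es j \<and> level es v j = 0} =
    (\<Union>p\<in>rivals es. {v. snd p = slope es (fst p) \<and> level es v (fst p) = 0})"
    by (auto simp: split_beta)
  moreover have "(\<Union>p\<in>rivals es. {v. snd p = slope es (fst p) \<and> level es v (fst p) = 0}) \<in> sets borel"
    by (rule sets.finite_UN[OF fin]) simp
  ultimately show ?thesis
    unfolding next_knot_def eq by (intro measurable_If) simp_all
qed

lemma borel_measurable_lars_knot: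
  assumes J: "fst ` set es \<subseteq> J"
  shows "(\<lambda>v. lars_knot X J v es i) \<in> borel_measurable borel"
proof -
  have Suc: "(\<lambda>v. lars_knot X J v es (Suc i)) \<in> borel_measurable borel" for i
  proof (induction i)
    case 0
    have "(\<lambda>v. Max ((\<lambda>j. \<bar>X j \<bullet> v\<bar>) ` J)) \<in> borel_measurable borel"
      by (rule borel_measurable_Max[OF finite_J]) simp
    then show ?case by simp
  next
    case (Suc i)
    show ?case
      unfolding lars_knot_Suc_Suc[OF active_take_subset[OF J]]
      by (intro borel_measurable_ereal borel_measurable_next_knot Suc)
  qed
  show ?thesis by (cases i) (simp_all only: lars_knot.simps(1) Suc borel_measurable_const)
qed

lemma next_knot_less_iff:
  assumes nz: "\<forall>(j, s)\<in>rivals es. s = slope es j \<longrightarrow> s * level es v j < 0"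
  shows "next_knot es v \<infinity> < h \<longleftrightarrow>
    0 < h \<and> (\<forall>p\<in>rivals es. snd p \<noteq> slope es (fst p) \<longrightarrow> candidate es v p < h)"
proof -
  have "\<not> (\<exists>(j, s)\<in>rivals es. s = slope es j \<and> level es v j = 0)"
    using nz by force
  then have "next_knot es v \<infinity> = Max (insert 0 ((\<lambda>p. if snd p \<noteq> slope es (fst p) \<and> 0 \<le> candidate es v p
                     then candidate es v p else 0) ` rivals es))"
    by (simp add: next_knot_def)
  then show ?thesis
    using finite_rivals[of es] by (auto split: if_splits)
qed

text \<open>
  The condition \<open>s * (level + h * slope) < h\<close> is solved for \<open>h\<close> if \<open>s * slope < 1\<close>; if \<open>s = slope\<close>, the
  terms in \<open>h\<close> cancel and a sign condition on the level remains.
\<close>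

lemma last_gap_iff:
  assumes path: "signed_path es"
  shows "last_gap es v h \<longleftrightarrow>
    (\<forall>(j, s)\<in>rivals es. s = slope es j \<longrightarrow> s * level es v j < 0) \<and> next_knot es v \<infinity> < h"
proof -
  have A: "active es \<subseteq> J" using signed_pathD(2)[OF path, of "length es"] by simp
  have rival: "s * (level es v j + h * slope es j) < h \<longleftrightarrow>
      (s = slope es j \<longrightarrow> s * level es v j < 0) \<and> (s \<noteq> slope es j \<longrightarrow> candidate es v (j, s) < h)"
    if p: "(j, s) \<in> rivals es" for j s
  proof (cases "s = slope es j")
    case True
    have "s * s = 1" using p by (auto simp: rivals_def)
    then show ?thesis using True by (simp add: distrib_left mult.left_commute)
  next
    case False
    have s: "s = -1 \<or> s = 1" using p by (auto simp: rivals_def)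
    have "\<bar>slope es j\<bar> \<le> 1"
      using slope_take_le_1[OF path, of j "length es"] p by (simp add: rivals_def)
    then have "s * slope es j < 1" using s False by (auto simp: abs_le_iff)
    moreover have "candidate es v (j, s) = s * level es v j / (1 - s * slope es j)"
    proof -
      have "level es v j / (s - slope es j) = (s * level es v j) / (s * (s - slope es j))"
        using s by auto
      also have "s * (s - slope es j) = 1 - s * slope es j" using s by (auto simp: algebra_simps)
      finally show ?thesis by (simp add: candidate_def)
    qed
    ultimately show ?thesis using False by (simp add: divide_less_eq algebra_simps)
  qed
  have abs: "\<bar>x\<bar> < h \<longleftrightarrow> -1 * x < h \<and> 1 * x < h" for x by auto
  have "(\<forall>j\<in>J - active es. \<bar>X j \<bullet> lars_resid X v es h\<bar> < h) \<longleftrightarrow>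
      (\<forall>(j, s)\<in>rivals es. s * (level es v j + h * slope es j) < h)"
    unfolding abs inner_resid[OF A] rivals_def by auto
  also have "\<dots> \<longleftrightarrow> (\<forall>(j, s)\<in>rivals es. s = slope es j \<longrightarrow> s * level es v j < 0) \<and>
      (\<forall>p\<in>rivals es. snd p \<noteq> slope es (fst p) \<longrightarrow> candidate es v p < h)"
    using rival by (fastforce simp: split_beta)
  finally show ?thesis
    unfolding last_gap_def using next_knot_less_iff by blast
qed

lemma next_knot_eq:
  assumes path: "signed_path es" and gap: "last_gap es v h"
  shows "next_knot es v (ereal h) = next_knot es v \<infinity>"
proof -
  have 1: "\<forall>(j, s)\<in>rivals es. s = slope es j \<longrightarrow> s * level es v j < 0" and "next_knot es v \<infinity> < h"
    using gap last_gap_iff[OF path] by auto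
  then have "candidate es v p < h" if "p \<in> rivals es" "snd p \<noteq> slope es (fst p)" for p
    using next_knot_less_iff[OF 1, of h] that by blast
  then have "(\<lambda>p. if snd p \<noteq> slope es (fst p) \<and> 0 \<le> candidate es v p \<and> ereal (candidate es v p) < ereal h
                     then candidate es v p else 0) ` rivals es =
    (\<lambda>p. if snd p \<noteq> slope es (fst p) \<and> 0 \<le> candidate es v p \<and> ereal (candidate es v p) < \<infinity>
                     then candidate es v p else 0) ` rivals es"
    by (intro image_cong) auto
  then show ?thesis unfolding next_knot_def by presburger
qed

lemma level_direction_orthogonal:
  assumes "A \<subseteq> J" "w \<in> span (X ` A)"
  shows "(u - proj_on X A u) \<bullet> w = 0"
  using inner_proj_on[OF assms, of u] by (simp add: inner_diff_left inner_diff_right inner_commute)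

text \<open>
  \<open>level es\<close> is the inner product with a vector orthogonal to the active columns.
\<close>

lemma level_invariant:
  assumes "active es \<subseteq> J" "w \<in> span (X ` active es)"
  shows "level es (v + c *\<^sub>R w) j = level es v j"
  using level_direction_orthogonal[OF assms] by (simp add: level_def inner_add_right)

lemma lars_c_span: "lars_c X es j s \<in> span (X ` insert j (active es))"
proof -
  have "proj_on X (active es) w \<in> span (X ` insert j (active es))" for w
    using lsq_in_span[of X "active es"] span_mono[OF image_mono[OF subset_insertI[of "active es" j]]]
    by (auto simp: proj_on_def)
  then show ?thesis
    unfolding lars_c_def by (intro span_scale span_diff) (auto intro: span_base)
qed

lemma lars_c_orthogonal:
  assumes "active es \<subseteq> J" "w \<in> span (X ` active es)"
  shows "lars_c X es j s \<bullet> w = 0"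
  using level_direction_orthogonal[OF assms] by (simp add: lars_c_def)

lemma level_direction_nonzero:
  assumes "active es \<subseteq> J" "j \<in> J - active es"
  shows "X j - proj_on X (active es) (X j) \<noteq> 0"
proof -
  have "X j \<notin> span (X ` active es)" by (rule indep) (use assms in auto)
  then show ?thesis
    using lsq_in_span[of X "active es"] by (metis eq_iff_diff_eq_0 proj_on_def)
qed

lemma lars_c_nonzero:
  assumes "active es \<subseteq> J" "j \<in> J - active es" "s \<noteq> slope es j"
  shows "lars_c X es j s \<noteq> 0"
  using level_direction_nonzero[OF assms(1,2)] assms(3) by (simp add: lars_c_def slope_def)

section \<open>The selection event as an interval\<close>

text \<open>
  The part of the selection event that does not involve the last entry value.
\<close>

definition feasible :: "('i \<times> real) list \<Rightarrow> 'v \<Rightarrow> bool" where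
  "feasible es z \<longleftrightarrow>
     (\<forall>i. Suc (Suc i) < length es \<longrightarrow> entry_value es (Suc i) z < entry_value es i z) \<and>
     (\<forall>p\<in>rivals es. snd p = slope es (fst p) \<longrightarrow> snd p * level es z (fst p) < 0)"

definition prev_knot :: "('i \<times> real) list \<Rightarrow> 'v \<Rightarrow> ereal" where
  "prev_knot es z = (if length es = 1 then \<infinity> else ereal (entry_value es (length es - 2) z))"

lemma reaches_iff_interval:
  assumes path: "signed_path es" and gen: "lars_generic X J v" and n: "length es = Suc n"
  shows "lars_reaches X J v es \<longleftrightarrow> feasible es v \<and>
    next_knot es v \<infinity> < entry_value es n v \<and> ereal (entry_value es n v) < prev_knot es v"
proof -
  have "entries_ordered es v \<longleftrightarrow>
      (\<forall>i. Suc (Suc i) < length es \<longrightarrow> entry_value es (Suc i) v < entry_value es i v) \<and>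
      ereal (entry_value es n v) < prev_knot es v"
  proof (cases n)
    case (Suc m)
    have "Suc i < length es \<longleftrightarrow> Suc (Suc i) < length es \<or> i = m" for i using n Suc by auto
    then show ?thesis using n Suc by (auto simp: entries_ordered_def prev_knot_def)
  qed (use n in \<open>auto simp: entries_ordered_def prev_knot_def\<close>)
  then show ?thesis
    unfolding reaches_iff[OF path gen n] last_gap_iff[OF path] feasible_def by (auto simp: split_beta)
qed

lemma lars_knots_at_reached:
  assumes path: "signed_path es" and gen: "lars_generic X J v" and n: "length es = Suc n"
    and reach: "lars_reaches X J v es"
  shows "lars_knot X J v es n = prev_knot es v"
    "lars_knot X J v es (Suc n) = ereal (entry_value es n v)"
    "lars_knot X J v es (Suc (Suc n)) = ereal (next_knot es v \<infinity>)"
proof -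
  show "lars_knot X J v es n = prev_knot es v"
    using reaches_knot(1)[OF reach gen path, of "n - 1"] n by (cases n) (simp_all add: prev_knot_def)
  show knot: "lars_knot X J v es (Suc n) = ereal (entry_value es n v)"
    using reaches_knot(1)[OF reach gen path] n by simp
  have "last_gap es v (entry_value es n v)" using reach reaches_iff[OF path gen n] by blast
  from next_knot_eq[OF path this] show "lars_knot X J v es (Suc (Suc n)) = ereal (next_knot es v \<infinity>)"
    using lars_knot_Suc_Suc[OF signed_pathD(2)[OF path], of v n] n knot by (simp del: lars_knot.simps)
qed

text \<open>
  All the data of the selection apart from the last entry value depend on the response only through
  the levels after the last step and the earlier entry values.  This is what makes them functions of
  \<open>orth_part \<eta> y\<close>.
\<close>

lemma selection_cong:
  assumes lev: "\<And>j. j \<in> J \<Longrightarrow> level es v j = level es z j"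
    and ent: "\<And>i. Suc i < length es \<Longrightarrow> entry_value es i v = entry_value es i z"
  shows "feasible es v \<longleftrightarrow> feasible es z" "next_knot es v u = next_knot es z u"
    "es \<noteq> [] \<Longrightarrow> prev_knot es v = prev_knot es z"
proof -
  have r: "level es v (fst p) = level es z (fst p)" if "p \<in> rivals es" for p
    using that lev by (auto simp: rivals_def)
  then have c: "candidate es v p = candidate es z p" if "p \<in> rivals es" for p
    using that by (simp add: candidate_def split_beta)
  show "feasible es v \<longleftrightarrow> feasible es z"
    unfolding feasible_def using r ent by (metis Suc_lessD)
  have "(\<exists>(j, s)\<in>rivals es. s = slope es j \<and> level es v j = 0) \<longleftrightarrow>
      (\<exists>(j, s)\<in>rivals es. s = slope es j \<and> level es z j = 0)"
    by (rule bex_cong) (use r in auto)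
  moreover have "(\<lambda>p. if snd p \<noteq> slope es (fst p) \<and> 0 \<le> candidate es v p \<and> ereal (candidate es v p) < u
                     then candidate es v p else 0) ` rivals es =
      (\<lambda>p. if snd p \<noteq> slope es (fst p) \<and> 0 \<le> candidate es z p \<and> ereal (candidate es z p) < u
                     then candidate es z p else 0) ` rivals es"
    by (rule image_cong) (use c in auto)
  ultimately show "next_knot es v u = next_knot es z u" unfolding next_knot_def by presburger
  show "prev_knot es v = prev_knot es z" if "es \<noteq> []"
    using that ent[of "length es - 2"] by (cases "length es = 1") (auto simp: prev_knot_def Suc_diff_le le_Suc_eq neq_Nil_conv)
qed

lemma borel_measurable_entry_value: "(\<lambda>v. entry_value es i v) \<in> borel_measurable borel"
  unfolding entry_value_def by measurable

lemma feasible_sets: "Collect (feasible es) \<in> sets borel"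
proof -
  note [measurable] = borel_measurable_entry_value borel_measurable_level
  have "Collect (feasible es) =
    (\<Inter>i. {z. Suc (Suc i) < length es \<longrightarrow> entry_value es (Suc i) z < entry_value es i z}) \<inter>
    (UNIV - (\<Union>p\<in>rivals es. {z. \<not> (snd p = slope es (fst p) \<longrightarrow> snd p * level es z (fst p) < 0)}))"
    unfolding feasible_def by blast
  also have "\<dots> \<in> sets borel"
    by (intro sets.Int sets.countable_INT sets.compl_sets[of _ borel, simplified] sets.finite_UN finite_rivals) auto
  finally show ?thesis .
qed

lemma borel_measurable_prev_knot: "(\<lambda>v. prev_knot es v) \<in> borel_measurable borel"
  unfolding prev_knot_def using borel_measurable_entry_value by simp

lemma entry_direction_span:
  assumes i: "i < length es"
  shows "lars_c X (take i es) (fst (es ! i)) (snd (es ! i)) \<in> span (X ` active (take (Suc i) es))"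
  using lars_c_span by (simp add: active_take_Suc[OF i])

text \<open>
  The directions of entry are orthogonal, by the Gram-Schmidt process.
\<close>

lemma entry_value_orthogonal:
  assumes path: "signed_path es" and ij: "i < m" "m < length es"
  shows "entry_value es i (lars_c X (take m es) (fst (es ! m)) (snd (es ! m))) = 0"
proof -
  have "active (take (Suc i) es) \<subseteq> active (take m es)"
    using ij set_take_subset_set_take[of "Suc i" m es] by (auto simp: active_def)
  then have "lars_c X (take i es) (fst (es ! i)) (snd (es ! i)) \<in> span (X ` active (take m es))"
    using entry_direction_span[of i es] ij span_mono[OF image_mono] by (meson less_trans subsetD)
  from lars_c_orthogonal[OF signed_pathD(2)[OF path] this]
  show ?thesis unfolding entry_value_def by (subst inner_commute)
qed

end

lemma lars_design_Xtilde: "lars_design (Xtilde :: 'n::{finite,wellorder} \<Rightarrow> real^'n::_) diff_ix"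
proof
  show "finite (diff_ix :: 'n set)" by simp
  show "Xtilde j \<notin> span (Xtilde ` A)" if "j \<in> diff_ix" "A \<subseteq> diff_ix - {j}" for j :: 'n and A
    using Xtilde_not_in_span[OF that] .
  show "\<bar>Xtilde j \<bullet> w\<bar> \<le> 1"
    if "A \<subseteq> diff_ix" "w \<in> span (Xtilde ` A)" "\<And>a. a \<in> A \<Longrightarrow> \<bar>Xtilde a \<bullet> w\<bar> \<le> 1" "j \<in> diff_ix"
    for A and w :: "real^'n::_" and j :: 'n
    using Xtilde_abs_maximum_principle[OF that(2,1,3) _ that(4)] by simp
qed

section \<open>Isotropic normal vectors\<close>

lemma borel_measurable_component [measurable]:
  "(\<lambda>x::real^'n::{finite,wellorder}. x $ i) \<in> borel_measurable borel"
  by (intro borel_measurable_continuous_onI continuous_intros)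

lemma prod_Basis_vec:
  fixes F :: "real^'n::{finite,wellorder} \<Rightarrow> 'b::comm_monoid_mult"
  shows "(\<Prod>b\<in>Basis. F b) = (\<Prod>i\<in>UNIV. F (axis i 1))"
proof -
  have B: "(Basis :: (real^'n::{finite,wellorder}) set) = (\<lambda>i. axis i 1) ` UNIV"
    by (auto simp: Basis_vec_def)
  have "inj (\<lambda>i. axis i (1::real) :: real^'n::_)" by (auto simp: inj_on_def axis_eq_axis)
  then show ?thesis unfolding B by (subst prod.reindex) (simp_all add: o_def)
qed

text \<open>
  Orthogonal maps preserve the volume of boxes, which determines Lebesgue measure.
\<close>

lemma lborel_orthogonal_invariant:
  fixes Q :: "real^'n::{finite,wellorder} \<Rightarrow> real^'n::_"
  assumes Q: "orthogonal_transformation Q"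
  shows "distr lborel borel Q = lborel"
proof (rule lborel_eqI[symmetric])
  have lin: "linear Q" by (rule orthogonal_transformation_linear[OF Q])
  then have meas [measurable]: "Q \<in> borel_measurable borel"
    by (intro borel_measurable_continuous_onI linear_continuous_on linear_conv_bounded_linear[THEN iffD1])
  obtain R where R: "orthogonal_transformation R" "\<And>x. R (Q x) = x" "\<And>x. Q (R x) = x"
  proof
    show "orthogonal_transformation (inv Q)" by (rule orthogonal_transformation_inv[OF Q])
    show "inv Q (Q x) = x" "Q (inv Q x) = x" for x
      using orthogonal_transformation_bij[OF Q] by (simp_all add: bij_is_inj bij_is_surj surj_f_inv_f)
  qed
  fix l u :: "real^'n::_"
  assume lu: "\<And>b. b \<in> Basis \<Longrightarrow> l \<bullet> b \<le> u \<bullet> b"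
  have vim: "Q -` box l u = R ` box l u"
    using R(2,3) by (auto simp: image_iff) metis
  have meas_vim: "Q -` box l u \<in> sets borel"
    using measurable_sets[OF meas, of "box l u"] by simp
  have box: "box l u \<in> lmeasurable" by simp
  have "emeasure (distr lborel borel Q) (box l u) = emeasure lebesgue (R ` box l u)"
    using meas_vim by (simp add: emeasure_distr vim)
  also have "\<dots> = ennreal (measure lebesgue (R ` box l u))"
    by (rule emeasure_eq_measure2[OF measurable_orthogonal_image[OF R(1) box]])
  also have "\<dots> = emeasure lborel (box l u)"
    unfolding measure_orthogonal_image[OF R(1) box] using emeasure_eq_measure2[OF box] by simp
  finally show "emeasure (distr lborel borel Q) (box l u) = (\<Prod>b\<in>Basis. (u - l) \<bullet> b)"
    using lu by (simp add: emeasure_lborel_box)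
qed simp

lemma prod_normal_density:
  fixes x :: "real^'n::{finite,wellorder}"
  shows "(\<Prod>i\<in>UNIV. normal_density 0 \<sigma> (x $ i)) =
    (1 / sqrt (2 * pi * \<sigma>\<^sup>2)) ^ CARD('n) * exp (- (norm x)\<^sup>2 / (2 * \<sigma>\<^sup>2))"
proof -
  have "(norm x)\<^sup>2 = (\<Sum>i\<in>UNIV. (x $ i)\<^sup>2)"
    unfolding power2_norm_eq_inner inner_vec_def by (simp add: power2_eq_square)
  then show ?thesis
    by (simp add: normal_density_def prod.distrib exp_sum[symmetric] sum_divide_distrib sum_negf power_divide prod_dividef)
qed

lemma normal_singleton: "emeasure (density lborel (normal_density m s)) {x} = 0"
proof -
  have "absolutely_continuous lborel (density lborel (normal_density m s))"
    by (rule absolutely_continuousI_density) simp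
  moreover have "{x} \<in> null_sets lborel" by (rule finite_imp_null_set_lborel) simp
  ultimately show ?thesis
    unfolding absolutely_continuous_def by (blast intro: null_setsD1)
qed

context prob_space
begin

text \<open>
  The density depends on the norm only.
\<close>

lemma isotropic_rotate:
  fixes \<epsilon> :: "'a \<Rightarrow> real^'n::{finite,wellorder}"
  assumes noise: "distributed M lborel \<epsilon> (\<lambda>x. ennreal (\<Prod>i\<in>UNIV. normal_density 0 \<sigma> (x $ i)))"
    and Q: "orthogonal_transformation (Q :: real^'n::_ \<Rightarrow> real^'n::_)"
  shows "distributed M lborel (\<lambda>w. Q (\<epsilon> w)) (\<lambda>x. ennreal (\<Prod>i\<in>UNIV. normal_density 0 \<sigma> (x $ i)))"
proof -
  let ?f = "\<lambda>x::real^'n::_. ennreal (\<Prod>i\<in>UNIV. normal_density 0 \<sigma> (x $ i))"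
  have lin: "linear Q" by (rule orthogonal_transformation_linear[OF Q])
  then have meas [measurable]: "Q \<in> borel_measurable borel"
    by (intro borel_measurable_continuous_onI linear_continuous_on linear_conv_bounded_linear[THEN iffD1])
  have [measurable]: "\<epsilon> \<in> measurable M borel" using distributed_measurable[OF noise] by simp
  have inv: "?f (Q x) = ?f x" for x
    unfolding prod_normal_density using Q by (simp add: orthogonal_transformation)
  have f [measurable]: "?f \<in> borel_measurable borel" by measurable
  have "distr M lborel (\<lambda>w. Q (\<epsilon> w)) = distr (distr M lborel \<epsilon>) lborel Q"
    by (simp add: distr_distr o_def)
  also have "\<dots> = distr (density lborel (\<lambda>x. ?f (Q x))) lborel Q"
    unfolding inv distributed_distr_eq_density[OF noise] ..
  also have "\<dots> = density (distr lborel lborel Q) ?f"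
    by (rule density_distr[symmetric]) simp_all
  also have "distr lborel lborel Q = distr lborel borel Q" by (rule distr_cong) simp_all
  also have "\<dots> = lborel" by (rule lborel_orthogonal_invariant[OF Q])
  finally show ?thesis unfolding distributed_def by simp
qed

lemma isotropic_box:
  fixes \<epsilon> :: "'a \<Rightarrow> real^'n::{finite,wellorder}"
  assumes noise: "distributed M lborel \<epsilon> (\<lambda>x. ennreal (\<Prod>i\<in>UNIV. normal_density 0 \<sigma> (x $ i)))"
    and A: "\<And>i. A i \<in> sets borel"
  shows "emeasure M {w \<in> space M. \<forall>i. \<epsilon> w $ i \<in> A i} =
    (\<Prod>i\<in>UNIV. \<integral>\<^sup>+x. ennreal (normal_density 0 \<sigma> x) * indicator (A i) x \<partial>lborel)"
proof -
  let ?f = "\<lambda>x::real^'n::_. ennreal (\<Prod>i\<in>UNIV. normal_density 0 \<sigma> (x $ i))"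
  let ?g = "\<lambda>i x. ennreal (normal_density 0 \<sigma> x) * indicator (A i) x"
  have [measurable]: "\<And>i. A i \<in> sets borel" by (rule A)
  \<comment> \<open>The integral over a product is indexed by basis vectors, the density by coordinates.\<close>
  define ix where "ix b = (THE i. axis i (1::real) = b)" for b :: "real^'n::_"
  have ix: "ix (axis i 1) = i" for i unfolding ix_def by (rule the_equality) (auto simp: axis_eq_axis)
  let ?S = "{x::real^'n::_. \<forall>i. x $ i \<in> A i}"
  have S [measurable]: "?S \<in> sets borel"
  proof -
    have "?S = (\<Inter>i\<in>UNIV. {x. x $ i \<in> A i})" by auto
    also have "\<dots> \<in> sets borel" by (rule sets.finite_INT) auto
    finally show ?thesis .
  qed
  have "emeasure M {w \<in> space M. \<forall>i. \<epsilon> w $ i \<in> A i} = emeasure M (\<epsilon> -` ?S \<inter> space M)"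
    by (rule arg_cong[where f="emeasure M"]) auto
  also have "\<dots> = (\<integral>\<^sup>+x. ?f x * indicator ?S x \<partial>lborel)"
    by (rule distributed_emeasure[OF noise]) simp
  also have "\<dots> = (\<integral>\<^sup>+x. (\<Prod>b\<in>Basis. ?g (ix b) (x \<bullet> b)) \<partial>lborel)"
  proof (rule nn_integral_cong)
    fix x :: "real^'n::_"
    have "(indicator ?S x :: ennreal) = (\<Prod>i\<in>UNIV. indicator (A i) (x $ i))"
      by (auto simp: indicator_def prod_zero_iff)
    then show "?f x * indicator ?S x = (\<Prod>b\<in>Basis. ?g (ix b) (x \<bullet> b))"
      by (simp add: prod_Basis_vec ix cart_eq_inner_axis[symmetric] prod.distrib prod_ennreal)
  qed
  also have "\<dots> = (\<Prod>b\<in>Basis. \<integral>\<^sup>+x. ?g (ix b) x \<partial>lborel)"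
    by (rule nn_integral_lborel_prod) simp_all
  finally show ?thesis by (simp add: prod_Basis_vec ix)
qed

lemma isotropic_component:
  fixes \<epsilon> :: "'a \<Rightarrow> real^'n::{finite,wellorder}"
  assumes noise: "distributed M lborel \<epsilon> (\<lambda>x. ennreal (\<Prod>i\<in>UNIV. normal_density 0 \<sigma> (x $ i)))"
    and \<sigma>: "0 < \<sigma>"
  shows "distributed M lborel (\<lambda>w. \<epsilon> w $ i) (\<lambda>x. ennreal (normal_density 0 \<sigma> x))"
  unfolding distributed_def
proof (intro conjI)
  have [measurable]: "\<epsilon> \<in> measurable M borel" using distributed_measurable[OF noise] by simp
  show "(\<lambda>w. \<epsilon> w $ i) \<in> measurable M lborel" by simp
  have one: "(\<integral>\<^sup>+x. ennreal (normal_density 0 \<sigma> x) \<partial>lborel) = 1"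
    using prob_space.emeasure_space_1[OF prob_space_normal_density[OF \<sigma>, of 0]]
    by (simp add: emeasure_density)
  show "distr M lborel (\<lambda>w. \<epsilon> w $ i) = density lborel (\<lambda>x. ennreal (normal_density 0 \<sigma> x))"
  proof (rule measure_eqI)
    fix B assume "B \<in> sets (distr M lborel (\<lambda>w. \<epsilon> w $ i))"
    then have B [measurable]: "B \<in> sets borel" by simp
    define A where "A l = (if l = i then B else UNIV)" for l
    have "emeasure (distr M lborel (\<lambda>w. \<epsilon> w $ i)) B = emeasure M {w \<in> space M. \<forall>l. \<epsilon> w $ l \<in> A l}"
      by (subst emeasure_distr) (auto intro!: arg_cong[where f="emeasure M"] simp: A_def)
    also have "\<dots> = (\<Prod>l\<in>UNIV. \<integral>\<^sup>+x. ennreal (normal_density 0 \<sigma> x) * indicator (A l) x \<partial>lborel)"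
      by (rule isotropic_box[OF noise]) (simp add: A_def)
    also have "\<dots> = (\<Prod>l\<in>UNIV. if l = i then \<integral>\<^sup>+x. ennreal (normal_density 0 \<sigma> x) * indicator B x \<partial>lborel else 1)"
      by (rule prod.cong) (auto simp: A_def one)
    also have "\<dots> = emeasure (density lborel (\<lambda>x. ennreal (normal_density 0 \<sigma> x))) B"
      by (simp add: emeasure_density)
    finally show "emeasure (distr M lborel (\<lambda>w. \<epsilon> w $ i)) B =
      emeasure (density lborel (\<lambda>x. ennreal (normal_density 0 \<sigma> x))) B" .
  qed simp
qed simp

lemma isotropic_indep:
  fixes \<epsilon> :: "'a \<Rightarrow> real^'n::{finite,wellorder}"
  assumes noise: "distributed M lborel \<epsilon> (\<lambda>x. ennreal (\<Prod>i\<in>UNIV. normal_density 0 \<sigma> (x $ i)))"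
    and \<sigma>: "0 < \<sigma>"
  shows "indep_vars (\<lambda>_. borel) (\<lambda>i w. \<epsilon> w $ i) UNIV"
proof -
  have [measurable]: "\<epsilon> \<in> measurable M borel" using distributed_measurable[OF noise] by simp
  have comp: "emeasure (distr M borel (\<lambda>w. \<epsilon> w $ i)) B = (\<integral>\<^sup>+x. ennreal (normal_density 0 \<sigma> x) * indicator B x \<partial>lborel)"
    if "B \<in> sets borel" for i B
    using distributed_emeasure[OF isotropic_component[OF noise \<sigma>, of i], of B] that
    by (simp add: emeasure_distr)
  interpret D: product_sigma_finite "\<lambda>i. distr M borel (\<lambda>w. \<epsilon> w $ i)"
    by (auto intro!: product_sigma_finite.intro prob_space_imp_sigma_finite prob_space_distr)
  have "PiM UNIV (\<lambda>i. distr M borel (\<lambda>w. \<epsilon> w $ i)) = distr M (PiM UNIV (\<lambda>_. borel)) (\<lambda>w. \<lambda>i\<in>UNIV. \<epsilon> w $ i)"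
  proof (rule D.PiM_eqI[symmetric])
    show "sets (distr M (PiM UNIV (\<lambda>_. borel)) (\<lambda>w. \<lambda>i\<in>UNIV. \<epsilon> w $ i)) =
        sets (PiM UNIV (\<lambda>i. distr M borel (\<lambda>w. \<epsilon> w $ i)))"
      by (simp cong: sets_PiM_cong)
    fix A assume "\<And>i. i \<in> UNIV \<Longrightarrow> A i \<in> sets (distr M borel (\<lambda>w. \<epsilon> w $ i))"
    then have A [measurable]: "\<And>i. A i \<in> sets borel" by simp
    have "emeasure (distr M (PiM UNIV (\<lambda>_. borel)) (\<lambda>w. \<lambda>i\<in>UNIV. \<epsilon> w $ i)) (Pi\<^sub>E UNIV A) =
        emeasure M {w \<in> space M. \<forall>i. \<epsilon> w $ i \<in> A i}"
      by (subst emeasure_distr) (auto intro!: arg_cong[where f="emeasure M"] sets_PiM_I_finite)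
    then show "emeasure (distr M (PiM UNIV (\<lambda>_. borel)) (\<lambda>w. \<lambda>i\<in>UNIV. \<epsilon> w $ i)) (Pi\<^sub>E UNIV A) =
        (\<Prod>i\<in>UNIV. emeasure (distr M borel (\<lambda>w. \<epsilon> w $ i)) (A i))"
      using isotropic_box[OF noise A] by (simp add: comp[OF A])
  qed simp
  then show ?thesis
    by (subst indep_vars_iff_distr_eq_PiM) simp_all
qed

lemma sets_vimage_algebra_factor:
  fixes h :: "'c \<Rightarrow> 'd::topological_space"
  assumes K: "K \<in> measurable M V" and h: "h \<in> borel_measurable V"
    and Y: "\<And>w. w \<in> space M \<Longrightarrow> Y w = h (K w)"
  shows "sets (vimage_algebra (space M) Y borel) \<subseteq> sigma_sets (space M) {K -` A \<inter> space M | A. A \<in> sets V}"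
proof
  fix B assume "B \<in> sets (vimage_algebra (space M) Y borel)"
  then obtain A where A: "A \<in> sets borel" "B = Y -` A \<inter> space M"
    by (auto simp: sets_vimage_algebra2)
  have "B = K -` (h -` A \<inter> space V) \<inter> space M"
    using A(2) Y measurable_space[OF K] by auto
  then show "B \<in> sigma_sets (space M) {K -` A \<inter> space M | A. A \<in> sets V}"
    using measurable_sets[OF h A(1)] by (intro sigma_sets.Basic) blast
qed

lemma indep_var_imp_indep_set:
  assumes ind: "indep_var S F T G"
    and f: "f \<in> borel_measurable S" and g: "g \<in> borel_measurable T"
    and X: "\<And>w. w \<in> space M \<Longrightarrow> X w = f (F w)" and Z: "\<And>w. w \<in> space M \<Longrightarrow> Z w = g (G w)"
  shows "indep_set (sets (vimage_algebra (space M) X borel)) (sets (vimage_algebra (space M) Z borel))"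
proof -
  have F: "F \<in> measurable M S" and G: "G \<in> measurable M T"
    and indF: "indep_set (sigma_sets (space M) {F -` A \<inter> space M | A. A \<in> sets S})
      (sigma_sets (space M) {G -` A \<inter> space M | A. A \<in> sets T})"
    using ind by (auto simp: indep_var_eq)
  note sub = sets_vimage_algebra_factor[OF F f X] sets_vimage_algebra_factor[OF G g Z]
  show ?thesis
    using indF unfolding indep_set_def
    by (rule indep_sets_mono_sets) (use sub in \<open>auto split: bool.split\<close>)
qed

text \<open>
  Rotate the vector so that \<open>\<eta>\<close> becomes a multiple of a coordinate axis.  Then \<open>\<eta> \<bullet> y\<close> depends on that coordinate
  and \<open>orth_part \<eta> y\<close> on the others.
\<close>

lemma isotropic_direction:
  fixes \<epsilon> :: "'a \<Rightarrow> real^'n::{finite,wellorder}" and \<mu> \<eta> :: "real^'n::_"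
  assumes noise: "distributed M lborel \<epsilon> (\<lambda>x. ennreal (\<Prod>i\<in>UNIV. normal_density 0 \<sigma> (x $ i)))"
    and \<sigma>: "0 < \<sigma>" and \<eta>: "\<eta> \<noteq> 0"
  shows "indep_set (sets (vimage_algebra (space M) (\<lambda>w. \<eta> \<bullet> (\<mu> + \<epsilon> w)) borel))
      (sets (vimage_algebra (space M) (\<lambda>w. orth_part \<eta> (\<mu> + \<epsilon> w)) borel))"
    and "distributed M lborel (\<lambda>w. \<eta> \<bullet> (\<mu> + \<epsilon> w)) (normal_density (\<eta> \<bullet> \<mu>) (\<sigma> * norm \<eta>))"
proof -
  define k :: 'n where "k = undefined"
  have "norm (axis k (norm \<eta>)) = norm \<eta>" by (simp add: norm_vec_def L2_set_def axis_def if_distrib[where f="\<lambda>x. x\<^sup>2"] sum_nonneg cong: if_cong)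
  then obtain Q where Q: "orthogonal_transformation Q" and Qk: "Q (axis k (norm \<eta>)) = \<eta>"
    using orthogonal_transformation_exists by blast
  have lin: "linear Q" by (rule orthogonal_transformation_linear[OF Q])
  have bij: "bij Q" by (rule orthogonal_transformation_bij[OF Q])
  let ?R = "inv Q"
  have R: "orthogonal_transformation ?R" by (rule orthogonal_transformation_inv[OF Q])
  have QR: "Q (?R x) = x" for x using bij by (simp add: bij_is_surj surj_f_inv_f)
  define e where "e w = ?R (\<epsilon> w)" for w
  have e: "distributed M lborel e (\<lambda>x. ennreal (\<Prod>i\<in>UNIV. normal_density 0 \<sigma> (x $ i)))"
    unfolding e_def by (rule isotropic_rotate[OF noise R])
  have eps: "\<epsilon> w = (\<Sum>i\<in>UNIV. e w $ i *\<^sub>R Q (axis i 1))" for w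
  proof -
    have "e w = (\<Sum>i\<in>UNIV. e w $ i *\<^sub>R axis i 1)"
      using basis_expansion[of "e w"] by (simp add: scalar_mult_eq_scaleR)
    then have "Q (e w) = Q (\<Sum>i\<in>UNIV. e w $ i *\<^sub>R axis i 1)" by simp
    then show ?thesis by (simp add: e_def QR linear_sum[OF lin] linear_scale[OF lin])
  qed
  have "axis k (norm \<eta>) = norm \<eta> *\<^sub>R axis k (1::real)" by (simp add: vec_eq_iff axis_def)
  then have eta: "\<eta> = norm \<eta> *\<^sub>R Q (axis k 1)" using Qk linear_scale[OF lin] by metis
  have inner: "\<eta> \<bullet> \<epsilon> w = norm \<eta> * e w $ k" for w
  proof -
    have "\<eta> \<bullet> \<epsilon> w = Q (axis k (norm \<eta>)) \<bullet> Q (e w)" by (simp add: Qk e_def QR)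
    also have "\<dots> = axis k (norm \<eta>) \<bullet> e w" using Q by (simp add: orthogonal_transformation_def)
    finally show ?thesis by (simp add: inner_axis')
  qed
  have orth: "orth_part \<eta> (\<mu> + \<epsilon> w) = orth_part \<eta> \<mu> + (\<Sum>i\<in>UNIV - {k}. e w $ i *\<^sub>R Q (axis i 1))" for w
  proof -
    have "((\<eta> \<bullet> \<epsilon> w) / (norm \<eta>)\<^sup>2) *\<^sub>R \<eta> = (((\<eta> \<bullet> \<epsilon> w) / (norm \<eta>)\<^sup>2) * norm \<eta>) *\<^sub>R Q (axis k 1)"
      using eta by (metis scaleR_scaleR)
    also have "\<dots> = e w $ k *\<^sub>R Q (axis k 1)"
      using \<eta> by (simp add: inner power2_eq_square)
    finally have "((\<eta> \<bullet> \<epsilon> w) / (norm \<eta>)\<^sup>2) *\<^sub>R \<eta> = e w $ k *\<^sub>R Q (axis k 1)" .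
    moreover have "\<epsilon> w = e w $ k *\<^sub>R Q (axis k 1) + (\<Sum>i\<in>UNIV - {k}. e w $ i *\<^sub>R Q (axis i 1))"
      by (subst eps) (rule sum.remove, simp_all)
    ultimately show ?thesis
      by (simp add: orth_part_def inner_add_right add_divide_distrib scaleR_add_left algebra_simps)
  qed
  have "indep_var (PiM {k} (\<lambda>_. borel)) (\<lambda>w. restrict (\<lambda>i. e w $ i) {k})
      (PiM (UNIV - {k}) (\<lambda>_. borel)) (\<lambda>w. restrict (\<lambda>i. e w $ i) (UNIV - {k}))"
    by (rule indep_var_restrict[OF isotropic_indep[OF e \<sigma>]]) auto
  then show "indep_set (sets (vimage_algebra (space M) (\<lambda>w. \<eta> \<bullet> (\<mu> + \<epsilon> w)) borel))
      (sets (vimage_algebra (space M) (\<lambda>w. orth_part \<eta> (\<mu> + \<epsilon> w)) borel))"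
  proof (rule indep_var_imp_indep_set)
    show "(\<lambda>f. \<eta> \<bullet> \<mu> + norm \<eta> * f k) \<in> borel_measurable (PiM {k} (\<lambda>_. borel))" by simp
    show "(\<lambda>f. orth_part \<eta> \<mu> + (\<Sum>i\<in>UNIV - {k}. f i *\<^sub>R Q (axis i 1))) \<in> borel_measurable (PiM (UNIV - {k}) (\<lambda>_. borel))"
      by (intro borel_measurable_add borel_measurable_sum borel_measurable_scaleR borel_measurable_const
          measurable_component_singleton)
  qed (simp_all add: orth inner inner_add_right)
  have "distributed M lborel (\<lambda>w. \<eta> \<bullet> \<mu> + norm \<eta> * e w $ k) (normal_density (\<eta> \<bullet> \<mu> + norm \<eta> * 0) (\<bar>norm \<eta>\<bar> * \<sigma>))"
    by (rule normal_density_affine[OF isotropic_component[OF e \<sigma>]]) (use \<sigma> \<eta> in auto)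
  then show "distributed M lborel (\<lambda>w. \<eta> \<bullet> (\<mu> + \<epsilon> w)) (normal_density (\<eta> \<bullet> \<mu>) (\<sigma> * norm \<eta>))"
    by (simp add: inner inner_add_right mult.commute)
qed

lemma isotropic_nonzero:
  fixes \<epsilon> :: "'a \<Rightarrow> real^'n::{finite,wellorder}" and \<mu> d :: "real^'n::_"
  assumes noise: "distributed M lborel \<epsilon> (\<lambda>x. ennreal (\<Prod>i\<in>UNIV. normal_density 0 \<sigma> (x $ i)))"
    and \<sigma>: "0 < \<sigma>" and d: "d \<noteq> 0"
  shows "AE w in M. d \<bullet> (\<mu> + \<epsilon> w) \<noteq> 0"
proof -
  note D = isotropic_direction(2)[OF noise \<sigma> d, of \<mu>]
  have "AE x in density lborel (normal_density (d \<bullet> \<mu>) (\<sigma> * norm d)). x \<noteq> 0"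
    by (rule AE_I[of _ _ "{0}"]) (auto simp: normal_singleton)
  then have "AE x in distr M lborel (\<lambda>w. d \<bullet> (\<mu> + \<epsilon> w)). x \<noteq> 0"
    unfolding distributed_distr_eq_density[OF D] .
  then show ?thesis
    by (subst (asm) AE_distr_iff) (use distributed_measurable[OF D] in auto)
qed

end

section \<open>Selection of a normal variable by an independent interval\<close>

definition slice :: "ereal \<Rightarrow> ereal \<Rightarrow> real set" where
  "slice a b = {x. a \<le> ereal x \<and> ereal x \<le> b}"

lemma slice_sets [measurable]: "slice a b \<in> sets borel"
  unfolding slice_def by measurable

text \<open>
  Fubini's theorem for independent variables of possibly different types, which is why independence is
  stated for the generated \<open>\<sigma>\<close>-algebras.
\<close>

lemma (in prob_space) nn_integral_indep:
  fixes X :: "'a \<Rightarrow> 'b::second_countable_topology" and Z :: "'a \<Rightarrow> 'c::second_countable_topology"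
  assumes ind: "indep_set (sets (vimage_algebra (space M) X borel)) (sets (vimage_algebra (space M) Z borel))"
    and XZ [measurable]: "X \<in> borel_measurable M" "Z \<in> borel_measurable M"
    and f [measurable]: "f \<in> borel_measurable (borel \<Otimes>\<^sub>M borel)"
  shows "(\<integral>\<^sup>+w. f (X w, Z w) \<partial>M) = (\<integral>\<^sup>+w. (\<integral>\<^sup>+x. f (x, Z w) \<partial>distr M borel X) \<partial>M)"
proof -
  interpret DX: prob_space "distr M borel X" by (rule prob_space_distr) simp
  interpret DZ: prob_space "distr M borel Z" by (rule prob_space_distr) simp
  interpret P: pair_sigma_finite "distr M borel X" "distr M borel Z" ..
  have joint: "distr M borel X \<Otimes>\<^sub>M distr M borel Z = distr M (borel \<Otimes>\<^sub>M borel) (\<lambda>w. (X w, Z w))"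
  proof (rule pair_measure_eqI)
    show "sets (distr M borel X \<Otimes>\<^sub>M distr M borel Z) = sets (distr M (borel \<Otimes>\<^sub>M borel) (\<lambda>w. (X w, Z w)))"
      by (simp cong: sets_pair_measure_cong)
    fix A B assume "A \<in> sets (distr M borel X)" "B \<in> sets (distr M borel Z)"
    then have AB [measurable]: "A \<in> sets borel" "B \<in> sets borel" by simp_all
    have "prob ((X -` A \<inter> space M) \<inter> (Z -` B \<inter> space M)) = prob (X -` A \<inter> space M) * prob (Z -` B \<inter> space M)"
      by (rule indep_setD[OF ind]) (auto simp: sets_vimage_algebra2)
    moreover have "(X -` A \<inter> space M) \<inter> (Z -` B \<inter> space M) = (\<lambda>w. (X w, Z w)) -` (A \<times> B) \<inter> space M"
      by auto
    ultimately show "emeasure (distr M borel X) A * emeasure (distr M borel Z) B =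
        emeasure (distr M (borel \<Otimes>\<^sub>M borel) (\<lambda>w. (X w, Z w))) (A \<times> B)"
      by (simp add: emeasure_distr emeasure_eq_measure ennreal_mult)
  qed unfold_locales
  have "(\<integral>\<^sup>+w. f (X w, Z w) \<partial>M) = (\<integral>\<^sup>+p. f p \<partial>distr M (borel \<Otimes>\<^sub>M borel) (\<lambda>w. (X w, Z w)))"
    by (rule nn_integral_distr[symmetric]) simp_all
  also have "\<dots> = (\<integral>\<^sup>+z. (\<integral>\<^sup>+x. f (x, z) \<partial>distr M borel X) \<partial>distr M borel Z)"
    unfolding joint[symmetric] by (rule P.nn_integral_snd[symmetric]) simp
  also have "\<dots> = (\<integral>\<^sup>+w. (\<integral>\<^sup>+x. f (x, Z w) \<partial>distr M borel X) \<partial>M)"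
    by (rule nn_integral_distr) simp_all
  finally show ?thesis .
qed

text \<open>
  Abstract form of the selection event, with end points that are functions of a variable
  independent of the normal one.
\<close>

locale interval_selection = prob_space M for M :: "'w measure" +
  fixes X :: "'w \<Rightarrow> real" and Z :: "'w \<Rightarrow> 'v::euclidean_space" and m s :: real
    and E :: "'w set" and C :: "'v set" and L :: "'v \<Rightarrow> real" and U :: "'v \<Rightarrow> ereal"
  assumes indep: "indep_set (sets (vimage_algebra (space M) X borel)) (sets (vimage_algebra (space M) Z borel))"
    and Z_measurable [measurable]: "Z \<in> borel_measurable M"
    and normal: "distributed M lborel X (normal_density m s)" and s: "0 < s"
    and E [measurable]: "E \<in> sets M" and E_pos: "emeasure M E \<noteq> 0"
    and C [measurable]: "C \<in> sets borel"
    and L [measurable]: "L \<in> borel_measurable borel" and U [measurable]: "U \<in> borel_measurable borel"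
    and selection: "AE w in M. w \<in> E \<longleftrightarrow> Z w \<in> C \<and> L (Z w) < X w \<and> ereal (X w) < U (Z w)"
begin

abbreviation N :: "real measure" where "N \<equiv> density lborel (normal_density m s)"
abbreviation Q :: "'w measure" where "Q \<equiv> uniform_measure M E"
abbreviation interval :: "'v \<Rightarrow> real set" where "interval z \<equiv> slice (ereal (L z)) (U z)"

lemma X_measurable [measurable]: "X \<in> borel_measurable M"
  using distributed_measurable[OF normal] by simp

lemma prob_space_N: "prob_space N" by (rule prob_space_normal_density[OF s])

lemma prob_space_Q: "prob_space Q"
  by (rule prob_space_uniform_measure) (use E_pos in auto)

lemma indicator_interval_measurable [measurable]:
  "(\<lambda>p. indicator (interval (snd p)) (fst p) :: ennreal) \<in> borel_measurable (borel \<Otimes>\<^sub>M borel)"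
  unfolding slice_def indicator_def by measurable

lemma emeasure_interval_measurable:
  assumes B [measurable]: "B \<in> sets borel"
  shows "(\<lambda>z. emeasure N (interval z \<inter> B)) \<in> borel_measurable borel"
proof -
  interpret N: prob_space N by (rule prob_space_N)
  have "(\<lambda>z. \<integral>\<^sup>+x. indicator (interval z) x * indicator B x \<partial>N) \<in> borel_measurable borel"
  proof (rule N.borel_measurable_nn_integral)
    have "(\<lambda>p. indicator (interval (snd p)) (fst p) * indicator B (fst p) :: ennreal) \<in> borel_measurable (borel \<Otimes>\<^sub>M borel)"
      by measurable
    from measurable_compose[OF measurable_pair_swap' this]
    show "case_prod (\<lambda>z x. indicator (interval z) x * indicator B x :: ennreal) \<in> borel_measurable (borel \<Otimes>\<^sub>M N)"
      by (simp add: split_beta' cong: measurable_cong_sets)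
  qed
  moreover have "(\<integral>\<^sup>+x. indicator (interval z) x * indicator B x \<partial>N) = emeasure N (interval z \<inter> B)" for z
    by (simp add: indicator_inter_arith[symmetric])
  ultimately show ?thesis by simp
qed

text \<open>
  The end points of the interval carry no mass.
\<close>

lemma AE_N_endpoint: "AE x in N. L z < x \<and> ereal x < U z \<longleftrightarrow> x \<in> interval z"
proof -
  have "AE x in N. x \<noteq> a" for a
    by (rule AE_I[of _ _ "{a}"]) (auto simp: normal_singleton)
  then have "AE x in N. x \<noteq> L z \<and> x \<noteq> real_of_ereal (U z)" by (intro AE_conjI)
  then show ?thesis
  proof (rule AE_mp, intro AE_I2 impI)
    fix x assume "x \<noteq> L z \<and> x \<noteq> real_of_ereal (U z)"
    then show "L z < x \<and> ereal x < U z \<longleftrightarrow> x \<in> interval z"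
      by (cases "U z") (auto simp: slice_def)
  qed
qed

text \<open>
  Expectations given the selection event; every later statement about the conditional law is an instance.
\<close>

lemma nn_integral_Q:
  fixes G :: "real \<times> 'v \<Rightarrow> ennreal"
  assumes G [measurable]: "G \<in> borel_measurable (borel \<Otimes>\<^sub>M borel)"
  shows "(\<integral>\<^sup>+w. G (X w, Z w) \<partial>Q) =
    (\<integral>\<^sup>+w. indicator C (Z w) * (\<integral>\<^sup>+x. indicator (interval (Z w)) x * G (x, Z w) \<partial>N) \<partial>M) / emeasure M E"
proof -
  have sec [measurable]: "(\<lambda>x. G (x, z)) \<in> borel_measurable borel" for z
    by (rule measurable_compose[OF _ G]) simp
  define f :: "real \<times> 'v \<Rightarrow> ennreal" where
    "f p = indicator C (snd p) * (indicator {p. L (snd p) < fst p \<and> ereal (fst p) < U (snd p)} p * G p)" for p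
  have f: "f \<in> borel_measurable (borel \<Otimes>\<^sub>M borel)"
  proof -
    have "{p :: real \<times> 'v. L (snd p) < fst p \<and> ereal (fst p) < U (snd p)} =
       {p \<in> space (borel \<Otimes>\<^sub>M borel). L (snd p) < fst p \<and> ereal (fst p) < U (snd p)}"
      by (simp add: space_pair_measure)
    also have "\<dots> \<in> sets (borel \<Otimes>\<^sub>M borel)" by measurable
    finally have [measurable]: "{p :: real \<times> 'v. L (snd p) < fst p \<and> ereal (fst p) < U (snd p)} \<in> sets (borel \<Otimes>\<^sub>M borel)" .
    show ?thesis unfolding f_def by measurable
  qed
  have dX: "distr M borel X = N"
    using normal distr_cong[of M M borel lborel X X] by (simp add: distributed_def)
  have inner: "(\<integral>\<^sup>+x. f (x, z) \<partial>N) = indicator C z * (\<integral>\<^sup>+x. indicator (interval z) x * G (x, z) \<partial>N)" for z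
  proof -
    have "(\<integral>\<^sup>+x. f (x, z) \<partial>N) = (\<integral>\<^sup>+x. indicator C z * (indicator (interval z) x * G (x, z)) \<partial>N)"
      by (rule nn_integral_cong_AE, rule AE_mp[OF AE_N_endpoint[of z]])
         (auto simp: f_def split: split_indicator)
    then show ?thesis by (simp add: nn_integral_cmult)
  qed
  have "(\<integral>\<^sup>+w. G (X w, Z w) \<partial>Q) = (\<integral>\<^sup>+w. G (X w, Z w) * indicator E w \<partial>M) / emeasure M E"
    by (rule nn_integral_uniform_measure) simp_all
  also have "(\<integral>\<^sup>+w. G (X w, Z w) * indicator E w \<partial>M) = (\<integral>\<^sup>+w. f (X w, Z w) \<partial>M)"
    by (rule nn_integral_cong_AE, rule AE_mp[OF selection])
       (auto simp: f_def split: split_indicator)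
  also have "\<dots> = (\<integral>\<^sup>+w. (\<integral>\<^sup>+x. f (x, Z w) \<partial>N) \<partial>M)"
    using nn_integral_indep[OF indep X_measurable Z_measurable f] by (simp only: dX)
  finally show ?thesis by (simp only: inner)
qed

definition cond_law :: "real set \<Rightarrow> 'v \<Rightarrow> real" where
  "cond_law B z = measure (trunc_normal m s (ereal (L z)) (U z)) B"

text \<open>
  The product form holds for intervals of mass zero, too, since there both sides vanish.
\<close>

lemma ennreal_cond_law:
  assumes B: "B \<in> sets borel"
  shows "ennreal (cond_law B z) * emeasure N (interval z) = emeasure N (interval z \<inter> B)"
    and "cond_law B z = enn2real (emeasure N (interval z \<inter> B) / emeasure N (interval z))"
proof -
  interpret N: prob_space N by (rule prob_space_N)
  have "cond_law B z = enn2real (emeasure (uniform_measure N (interval z)) B)"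
    by (simp add: cond_law_def trunc_normal_def measure_def slice_def)
  also have "emeasure (uniform_measure N (interval z)) B = emeasure N (interval z \<inter> B) / emeasure N (interval z)"
    by (rule emeasure_uniform_measure) (use B in auto)
  finally show e: "cond_law B z = enn2real (emeasure N (interval z \<inter> B) / emeasure N (interval z))" .
  have le: "emeasure N (interval z \<inter> B) \<le> emeasure N (interval z)"
    by (rule emeasure_mono) auto
  show "ennreal (cond_law B z) * emeasure N (interval z) = emeasure N (interval z \<inter> B)"
  proof (cases "emeasure N (interval z) = 0")
    case True
    then show ?thesis using le by simp
  next
    case False
    have fin: "emeasure N (interval z) \<noteq> \<top>" "emeasure N (interval z \<inter> B) \<noteq> \<top>"
      using N.emeasure_finite by auto
    have "emeasure N (interval z \<inter> B) / emeasure N (interval z) \<noteq> \<top>"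
      using False fin by (simp add: ennreal_divide_eq_top_iff)
    then show ?thesis
      unfolding e using False fin ennreal_mult_divide_eq[of "emeasure N (interval z)" "emeasure N (interval z \<inter> B)"]
      by (simp add: ennreal_enn2real_if ennreal_times_divide mult.commute)
  qed
qed

lemma cond_law_measurable:
  assumes B: "B \<in> sets borel"
  shows "cond_law B \<in> borel_measurable borel"
proof -
  note emeasure_interval_measurable[OF B, measurable]
  have [measurable]: "(\<lambda>z. emeasure N (interval z)) \<in> borel_measurable borel"
    using emeasure_interval_measurable[of UNIV] by simp
  have "(\<lambda>z. enn2real (emeasure N (interval z \<inter> B) / emeasure N (interval z))) \<in> borel_measurable borel"
    using B by measurable
  then show ?thesis using ennreal_cond_law(2)[OF B] by (simp cong: measurable_cong)
qed


text \<open>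
  By \<open>nn_integral_Q\<close> both sides have the same integral over every set generated by \<open>Z\<close>: integrating out
  the normal variable replaces the indicator of \<open>B\<close> by the mass of \<open>B\<close> in the interval.
\<close>

lemma conditional_law:
  assumes B: "B \<in> sets borel"
  shows "AE w in Q. real_cond_exp Q (vimage_algebra (space Q) Z borel) (indicator {w \<in> space Q. X w \<in> B}) w = cond_law B (Z w)"
proof -
  let ?F = "vimage_algebra (space Q) Z borel"
  interpret Q: prob_space Q by (rule prob_space_Q)
  note B [measurable] cond_law_measurable[OF B, measurable]
  have Z' [measurable]: "Z \<in> borel_measurable Q" and X' [measurable]: "X \<in> borel_measurable Q" by simp_all
  have F: "sets ?F = {Z -` A \<inter> space Q | A. A \<in> sets borel}" by (rule sets_vimage_algebra2) simp
  have "subalgebra Q ?F"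
    unfolding subalgebra_def F using measurable_sets[OF Z'] by auto
  then interpret Q: finite_measure_subalgebra Q ?F
    by unfold_locales
  have bounds: "0 \<le> cond_law B z" "cond_law B z \<le> 1" for z
  proof -
    show "0 \<le> cond_law B z" by (simp add: cond_law_def)
    have le: "emeasure N (interval z \<inter> B) \<le> emeasure N (interval z)"
      by (rule emeasure_mono) auto
    show "cond_law B z \<le> 1"
    proof (cases "emeasure N (interval z) = 0")
      case True
      then show ?thesis using le by (simp add: ennreal_cond_law(2)[OF B])
    next
      case False
      then have "emeasure N (interval z \<inter> B) / emeasure N (interval z) \<le> 1"
        using le by (intro divide_le_posI_ennreal) (auto simp: zero_less_iff_neq_zero)
      then show ?thesis
        unfolding ennreal_cond_law(2)[OF B] using enn2real_mono[of _ 1] by fastforce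
    qed
  qed
  show ?thesis
  proof (rule Q.real_cond_exp_charact)
    have XB: "{w \<in> space Q. X w \<in> B} \<in> sets Q" by measurable
    show "integrable Q (indicator {w \<in> space Q. X w \<in> B} :: 'w \<Rightarrow> real)"
      using XB by (intro integrable_real_indicator) (auto simp: Q.emeasure_eq_measure)
    show "integrable Q (\<lambda>w. cond_law B (Z w))"
      by (rule Q.integrable_const_bound[where B=1]) (use bounds in auto)
    show "(\<lambda>w. cond_law B (Z w)) \<in> borel_measurable ?F"
      by (rule measurable_compose[OF measurable_vimage_algebra1 cond_law_measurable[OF B]]) simp
    fix A assume "A \<in> sets ?F"
    from this[unfolded F] obtain A' where A' [measurable]: "A' \<in> sets borel" and A: "A = Z -` A' \<inter> space Q"
      by auto
    have "(\<integral>\<^sup>+w. indicator A w * indicator {w \<in> space Q. X w \<in> B} w \<partial>Q) =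
        (\<integral>\<^sup>+w. indicator A' (Z w) * indicator B (X w) \<partial>Q)"
      by (rule nn_integral_cong) (auto simp: A split: split_indicator)
    also have "\<dots> = (\<integral>\<^sup>+w. indicator C (Z w) * (\<integral>\<^sup>+x. indicator (interval (Z w)) x * (indicator A' (Z w) * indicator B x) \<partial>N) \<partial>M) / emeasure M E"
      using nn_integral_Q[of "\<lambda>p. indicator A' (snd p) * indicator B (fst p)"] by simp
    also have "\<dots> = (\<integral>\<^sup>+w. indicator C (Z w) * (\<integral>\<^sup>+x. indicator (interval (Z w)) x * (indicator A' (Z w) * ennreal (cond_law B (Z w))) \<partial>N) \<partial>M) / emeasure M E"
    proof -
      have "(\<integral>\<^sup>+x. indicator (interval z) x * (indicator A' z * indicator B x) \<partial>N) =
          (\<integral>\<^sup>+x. indicator (interval z) x * (indicator A' z * ennreal (cond_law B z)) \<partial>N)" for z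
      proof -
        have "(\<integral>\<^sup>+x. indicator (interval z) x * (indicator A' z * indicator B x) \<partial>N) =
            (\<integral>\<^sup>+x. indicator A' z * indicator (interval z \<inter> B) x \<partial>N)"
          by (rule nn_integral_cong) (auto split: split_indicator)
        also have "\<dots> = indicator A' z * emeasure N (interval z \<inter> B)"
          by (rule nn_integral_cmult_indicator) simp
        also have "\<dots> = (indicator A' z * ennreal (cond_law B z)) * emeasure N (interval z)"
          by (simp add: ennreal_cond_law(1)[OF B, symmetric] mult.assoc)
        also have "\<dots> = (\<integral>\<^sup>+x. (indicator A' z * ennreal (cond_law B z)) * indicator (interval z) x \<partial>N)"
          by (rule nn_integral_cmult_indicator[symmetric]) simp
        finally show ?thesis by (simp only: mult.commute[of _ "indicator (interval z) _"])
      qed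
      then show ?thesis by simp
    qed
    also have "\<dots> = (\<integral>\<^sup>+w. indicator A' (Z w) * ennreal (cond_law B (Z w)) \<partial>Q)"
      using nn_integral_Q[of "\<lambda>p. indicator A' (snd p) * ennreal (cond_law B (snd p))"] by simp
    also have "\<dots> = (\<integral>\<^sup>+w. indicator A w * ennreal (cond_law B (Z w)) \<partial>Q)"
      by (rule nn_integral_cong) (auto simp: A split: split_indicator)
    finally have eq: "(\<integral>\<^sup>+w. indicator A w * indicator {w \<in> space Q. X w \<in> B} w \<partial>Q) =
      (\<integral>\<^sup>+w. indicator A w * ennreal (cond_law B (Z w)) \<partial>Q)" .
    have Am: "A \<in> sets Q" unfolding A by measurable
    show "(\<integral>w\<in>A. indicator {w \<in> space Q. X w \<in> B} w \<partial>Q) = (\<integral>w\<in>A. cond_law B (Z w) \<partial>Q)"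
      unfolding set_lebesgue_integral_def
    proof (subst (1 2) integral_eq_nn_integral)
      show "enn2real (\<integral>\<^sup>+w. ennreal (indicat_real A w *\<^sub>R indicat_real {w \<in> space Q. X w \<in> B} w) \<partial>Q) =
        enn2real (\<integral>\<^sup>+w. ennreal (indicat_real A w *\<^sub>R cond_law B (Z w)) \<partial>Q)"
        using eq by (simp add: ennreal_mult bounds ennreal_indicator)
    qed (use Am XB bounds in auto)
  qed
qed

end

lemma real_distribution_normal: "0 < s \<Longrightarrow> real_distribution (density lborel (normal_density m s))"
  using prob_space_normal_density[of s m] by (simp add: real_distribution_def real_distribution_axioms_def)

lemma Phi_scaled:
  assumes s: "0 < s"
  shows "Phi (a * ereal (1 / s)) = measure (density lborel (normal_density 0 s)) {x. ereal x \<le> a}"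
proof -
  interpret N: prob_space "density lborel (normal_density 0 s)" by (rule prob_space_normal_density[OF s])
  interpret S: prob_space std_normal_distribution by (rule prob_space_normal_density) simp
  show ?thesis
  proof (cases a)
    case (real r)
    have "distributed std_normal_distribution lborel (\<lambda>x. x) std_normal_density"
      by (simp add: distributed_def distr_id2)
    then have "distributed std_normal_distribution lborel (\<lambda>x. 0 + s * x) (normal_density (0 + s * 0) (\<bar>s\<bar> * 1))"
      by (rule S.normal_density_affine) (use s in auto)
    then have d: "distr std_normal_distribution lborel (\<lambda>x. s * x) = density lborel (normal_density 0 s)"
      using s by (simp add: distributed_def)
    have "measure (density lborel (normal_density 0 s)) {x. ereal x \<le> a} =
        measure (distr std_normal_distribution lborel (\<lambda>x. s * x)) {..r}"
      by (simp add: d real atMost_def)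
    also have "\<dots> = measure std_normal_distribution {..r / s}"
      using s by (subst measure_distr) (auto intro!: arg_cong[where f="measure _"] simp: pos_le_divide_eq mult.commute)
    finally show ?thesis using s by (simp add: Phi_def real cdf_def)
  next
    case PInf
    then show ?thesis using s N.prob_space by (simp add: Phi_def)
  next
    case MInf
    then show ?thesis using s by (simp add: Phi_def)
  qed
qed

lemma Phi_measurable [measurable]: "Phi \<in> borel_measurable borel"
proof -
  interpret S: real_distribution std_normal_distribution
    by (rule real_distribution_normal) simp
  have [measurable]: "cdf std_normal_distribution \<in> borel_measurable borel"
    by (intro borel_measurable_mono monoI S.cdf_nondecreasing)
  show ?thesis unfolding Phi_def by measurable
qed

text \<open>
  Monotonicity fixes the distribution function outside the open unit interval.
\<close>

lemma uniform_if_cdf_on_unit: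
  assumes D: "real_distribution D"
    and cdf: "\<And>t. 0 < t \<Longrightarrow> t < 1 \<Longrightarrow> measure D {..t} = t"
  shows "D = uniform_measure lborel {0..1}"
proof -
  have determined: "cdf D t = max 0 (min 1 t)"
    if D: "real_distribution D" and cdf: "\<And>t. 0 < t \<Longrightarrow> t < 1 \<Longrightarrow> cdf D t = t" for D t
  proof -
    interpret D: real_distribution D by (rule D)
    consider "t \<le> 0" | "0 < t" "t < 1" | "1 \<le> t" by linarith
    then show ?thesis
    proof cases
      case 1
      have "cdf D t \<le> 0"
      proof (rule field_le_epsilon)
        fix e :: real assume e: "0 < e"
        have "cdf D t \<le> cdf D (min e (1/2))" using 1 e by (intro D.cdf_nondecreasing) auto
        also have "\<dots> = min e (1/2)" using e by (intro cdf) auto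
        finally show "cdf D t \<le> 0 + e" by simp
      qed
      then show ?thesis using 1 D.cdf_nonneg[of t] by simp
    next
      case 2
      then show ?thesis using cdf by simp
    next
      case 3
      have "1 \<le> cdf D t"
      proof (rule field_le_epsilon)
        fix e :: real assume e: "0 < e"
        have "cdf D (max (1 - e) (1/2)) \<le> cdf D t" using 3 e by (intro D.cdf_nondecreasing) auto
        moreover have "cdf D (max (1 - e) (1/2)) = max (1 - e) (1/2)" using e by (intro cdf) auto
        ultimately show "1 \<le> cdf D t + e" by simp
      qed
      then show ?thesis using 3 D.cdf_bounded_prob[of t] by simp
    qed
  qed
  have V: "real_distribution (uniform_measure lborel {0..1::real})"
    using prob_space_uniform_measure[of lborel "{0..1::real}"]
    by (simp add: real_distribution_def real_distribution_axioms_def)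
  have "cdf (uniform_measure lborel {0..1}) t = t" if "0 < t" "t < 1" for t :: real
  proof -
    have "{0..1} \<inter> {..t} = {0..t}" using that by auto
    then show ?thesis using that by (simp add: cdf_def)
  qed
  then have "cdf D = cdf (uniform_measure lborel {0..1})"
    using determined[OF D] determined[OF V] cdf by (intro ext) (simp add: cdf_def)
  then show ?thesis by (rule cdf_unique[OF D V])
qed

text \<open>
  Probability integral transform for the truncated law.  The sublevel set of the normalized
  survival function is again an interval, whose left end \<open>x0\<close> is a quantile; it has exactly the mass
  prescribed because the distribution function is continuous.
\<close>

lemma (in real_distribution) truncated_survival_uniform:
  assumes atomless: "\<And>x. measure M {x} = 0" and t: "0 < t" "t < 1"
  defines "H \<equiv> \<lambda>a. measure M {x. ereal x \<le> a}"
  shows "measure M (slice (ereal l) u \<inter> {x. (H u - H (ereal x)) / (H u - H (ereal l)) \<le> t}) = t * measure M (slice (ereal l) u)"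
proof -
  interpret cdf_distribution M ..
  have H_real: "H (ereal x) = cdf M x" for x by (simp add: H_def cdf_def atMost_def)
  have H_mono: "a \<le> b \<Longrightarrow> H a \<le> H b" for a b
    unfolding H_def by (rule finite_measure_mono) (auto intro: order_trans)
  have slice: "measure M (slice (ereal a) u) = max 0 (H u - H (ereal a))" for a
  proof (cases "ereal a \<le> u")
    case True
    have "{x. ereal x \<le> u} = {x. ereal x \<le> ereal a} \<union> (slice (ereal a) u - {a})"
      using True by (cases u) (auto simp: slice_def)
    then have "H u = H (ereal a) + measure M (slice (ereal a) u - {a})"
      unfolding H_def by (subst finite_measure_Union[symmetric]) (auto simp: slice_def)
    moreover have "measure M (slice (ereal a) u - {a}) = measure M (slice (ereal a) u)"
      using atomless[of a] by (intro measure_Diff_null_set) (auto simp: null_sets_def emeasure_eq_measure)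
    ultimately show ?thesis by simp
  next
    case False
    then have "slice (ereal a) u = {}" by (auto simp: slice_def) (meson order_trans ereal_less_eq(3))
    then show ?thesis using False H_mono[of u "ereal a"] by simp
  qed
  show ?thesis
  proof (cases "H (ereal l) < H u")
    case False
    then have 0: "measure M (slice (ereal l) u) = 0" by (simp add: slice)
    have "measure M (slice (ereal l) u \<inter> S) \<le> measure M (slice (ereal l) u)" for S
      by (rule finite_measure_mono) auto
    then show ?thesis unfolding 0 by (simp add: measure_le_0_iff)
  next
    case True
    \<comment> \<open>The level of the distribution function at which the normalized survival function equals \<open>t\<close>.\<close>
    define c where "c = H u - t * (H u - H (ereal l))"
    have pos: "0 \<le> H (ereal l)" and le1: "H u \<le> 1" by (simp_all add: H_def)
    have "c = (1 - t) * H u + t * H (ereal l)" by (simp add: c_def algebra_simps)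
    moreover have "0 < (1 - t) * H u" "0 \<le> t * H (ereal l)" using t True pos by auto
    ultimately have c0: "0 < c" by linarith
    have "0 < t * (H u - H (ereal l))" "t * (H u - H (ereal l)) < H u - H (ereal l)"
      using t True mult_strict_right_mono[of t 1 "H u - H (ereal l)"] by auto
    then have cu: "c < H u" and cl: "H (ereal l) < c" unfolding c_def by linarith+
    have c1: "c < 1" using cu le1 by simp
    define x0 where "x0 = Inf {x. c \<le> cdf M x}"
    have x0: "c \<le> cdf M x \<longleftrightarrow> x0 \<le> x" for x
      unfolding x0_def by (rule pseudoinverse[OF c0 c1])
    have "cdf M x0 = c"
    proof (rule antisym)
      have "isCont (cdf M) x0" using atomless isCont_cdf by simp
      then have "(cdf M \<longlongrightarrow> cdf M x0) (at_left x0)"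
        by (simp add: isCont_def filterlim_at_split)
      moreover have "eventually (\<lambda>x. cdf M x \<le> c) (at_left x0)"
      proof (rule eventually_at_leftI)
        show "cdf M x \<le> c" if "x \<in> {x0 - 1<..<x0}" for x
          using x0[of x] that by auto
      qed simp
      ultimately show "cdf M x0 \<le> c" by (intro tendsto_upperbound) auto
    qed (use x0[of x0] in simp)
    have lx0: "l < x0" using x0[of l] cl by (simp add: H_real)
    have "(H u - H (ereal x)) / (H u - H (ereal l)) \<le> t \<longleftrightarrow> x0 \<le> x" for x
    proof -
      have "(H u - H (ereal x)) / (H u - H (ereal l)) \<le> t \<longleftrightarrow> c \<le> cdf M x"
        using True by (simp add: pos_divide_le_eq c_def H_real[of x] algebra_simps)
      then show ?thesis by (simp add: x0)
    qed
    then have "slice (ereal l) u \<inter> {x. (H u - H (ereal x)) / (H u - H (ereal l)) \<le> t} = slice (ereal x0) u"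
      using lx0 by (auto simp: slice_def)
    then show ?thesis
      using True cu \<open>cdf M x0 = c\<close> by (simp add: slice H_real[of x0]) (simp add: c_def)
  qed
qed

context interval_selection
begin

text \<open>
  Given \<open>Z\<close> the pivot is the normalized survival function of the truncated law, so it is
  uniform for every value of \<open>Z\<close> whose interval has positive mass.
\<close>

lemma pivot_uniform:
  fixes T :: "'w \<Rightarrow> real"
  assumes m: "m = 0" and T [measurable]: "T \<in> borel_measurable M"
    and T_eq: "AE w in M. w \<in> E \<longrightarrow> T w =
      (Phi (U (Z w) * ereal (1 / s)) - Phi (ereal (X w) * ereal (1 / s))) /
      (Phi (U (Z w) * ereal (1 / s)) - Phi (ereal (L (Z w)) * ereal (1 / s)))"
  shows "distr Q borel T = uniform_measure lborel {0..1}"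
proof (rule uniform_if_cdf_on_unit)
  interpret Q: prob_space Q by (rule prob_space_Q)
  interpret N: real_distribution N by (rule real_distribution_normal[OF s])
  show "real_distribution (distr Q borel T)" by (rule Q.real_distribution_distr) simp
  fix t :: real assume t: "0 < t" "t < 1"
  define tau where "tau x z = (Phi (U z * ereal (1 / s)) - Phi (ereal x * ereal (1 / s))) /
      (Phi (U z * ereal (1 / s)) - Phi (ereal (L z) * ereal (1 / s)))" for x z
  have tau [measurable]: "(\<lambda>p. tau (fst p) (snd p)) \<in> borel_measurable (borel \<Otimes>\<^sub>M borel)"
    unfolding tau_def by measurable
  have T_tau: "AE w in Q. T w = tau (X w) (Z w)"
    unfolding tau_def by (rule AE_uniform_measureI[OF E T_eq])
  have one: "(\<integral>\<^sup>+w. indicator C (Z w) * emeasure N (interval (Z w)) \<partial>M) / emeasure M E = 1"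
    using nn_integral_Q[of "\<lambda>_. 1"] Q.emeasure_space_1 by simp
  have inner: "(\<integral>\<^sup>+x. indicator (interval z) x * indicator {..t} (tau x z) \<partial>N) = ennreal t * emeasure N (interval z)" for z
  proof -
    have [measurable]: "(\<lambda>x. tau x z) \<in> borel_measurable borel"
      using measurable_compose[OF measurable_Pair2'[of z borel borel] tau] by simp
    have "(\<integral>\<^sup>+x. indicator (interval z) x * indicator {..t} (tau x z) \<partial>N) = (\<integral>\<^sup>+x. indicator (interval z \<inter> {x. tau x z \<le> t}) x \<partial>N)"
      by (rule nn_integral_cong) (auto split: split_indicator)
    also have "\<dots> = emeasure N (interval z \<inter> {x. tau x z \<le> t})" by simp
    also have "\<dots> = ennreal (t * measure N (interval z))"
    proof -
      have tau_eq: "{x. tau x z \<le> t} = {x. (measure N {x. ereal x \<le> U z} - measure N {xa. ereal xa \<le> ereal x}) /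
          (measure N {x. ereal x \<le> U z} - measure N {x. ereal x \<le> ereal (L z)}) \<le> t}"
        unfolding tau_def Phi_scaled[OF s] m ..
      have "measure N {x} = 0" for x using normal_singleton[of m s x] by (simp add: measure_def)
      from N.truncated_survival_uniform[OF this t, of "L z" "U z"] show ?thesis
        unfolding N.emeasure_eq_measure tau_eq by simp
    qed
    finally show ?thesis using t by (simp add: ennreal_mult N.emeasure_eq_measure)
  qed
  have "emeasure (distr Q borel T) {..t} = (\<integral>\<^sup>+w. indicator {..t} (T w) \<partial>Q)"
    by (subst nn_integral_indicator[symmetric], simp, subst nn_integral_distr) simp_all
  also have "\<dots> = (\<integral>\<^sup>+w. indicator {..t} (tau (X w) (Z w)) \<partial>Q)"
    by (rule nn_integral_cong_AE, rule AE_mp[OF T_tau]) simp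
  also have "\<dots> = (\<integral>\<^sup>+w. indicator C (Z w) * (ennreal t * emeasure N (interval (Z w))) \<partial>M) / emeasure M E"
    using nn_integral_Q[of "\<lambda>p. indicator {..t} (tau (fst p) (snd p))"] by (simp add: inner)
  also have "\<dots> = ennreal t * ((\<integral>\<^sup>+w. indicator C (Z w) * emeasure N (interval (Z w)) \<partial>M) / emeasure M E)"
  proof -
    have "(\<lambda>z. emeasure N (interval z)) \<in> borel_measurable borel"
      using emeasure_interval_measurable[of UNIV] by simp
    then have [measurable]: "(\<lambda>w. emeasure N (interval (Z w))) \<in> borel_measurable M" by (rule measurable_compose[OF Z_measurable])
    show ?thesis
      by (simp add: mult.left_commute[of "indicator _ _"] nn_integral_cmult ennreal_times_divide)
  qed
  finally have "emeasure (distr Q borel T) {..t} = ennreal t" by (simp add: one)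
  then show "measure (distr Q borel T) {..t} = t" using t by (simp add: measure_def)
qed

end

section \<open>The truncation interval and the pivot\<close>

theorem mainTheorem3:
  fixes M :: "'w measure"
    and \<mu> \<eta> :: "real^'n::{finite,wellorder}"
    and \<epsilon> y :: "'w \<Rightarrow> real^'n::_"
    and \<sigma> \<omega>\<^sub>k :: real
    and k :: nat
    and es :: "('n \<times> real) list"
    and E :: "'w set"
    and lam :: "nat \<Rightarrow> 'w \<Rightarrow> ereal"
    and T :: "'w \<Rightarrow> real"
  assumes n: "CARD('n) \<ge> 2"
    and M: "prob_space M"
    and sigma: "\<sigma> > 0"
    and noise: "distributed M lborel \<epsilon> (\<lambda>x. ennreal (\<Prod>i\<in>UNIV. normal_density 0 \<sigma> (x $ i)))"
    and y: "y = (\<lambda>w. \<mu> + \<epsilon> w)"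
    and generic: "AE w in M. lars_generic Xtilde diff_ix (ytilde (y w))"
    and k: "k \<ge> 1" "length es = k"
    and E: "E = {w \<in> space M. lars_reaches Xtilde diff_ix (ytilde (y w)) es}"
    and E_pos: "measure M E > 0"
    and lam: "lam = (\<lambda>i w. lars_knot Xtilde diff_ix (ytilde (y w)) es i)"
    and eta: "\<eta> = lars_c Xtilde (take (k - 1) es) (fst (es ! (k - 1))) (snd (es ! (k - 1)))"
    and omega: "\<omega>\<^sub>k = inverse (norm \<eta>)"
    and T: "T = (\<lambda>w. (Phi (lam (k - 1) w * ereal (\<omega>\<^sub>k / \<sigma>)) - Phi (lam k w * ereal (\<omega>\<^sub>k / \<sigma>))) /
                     (Phi (lam (k - 1) w * ereal (\<omega>\<^sub>k / \<sigma>)) - Phi (lam (k + 1) w * ereal (\<omega>\<^sub>k / \<sigma>))))"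
  shows "truncation_interval M E y \<mu> \<sigma> \<eta> (lam (k + 1)) (lam (k - 1)) \<and>
    (\<eta> \<bullet> \<mu> = 0 \<longrightarrow>
       T \<in> borel_measurable (uniform_measure M E) \<and>
       distr (uniform_measure M E) borel T = uniform_measure lborel {0..1})"
proof -
  interpret prob_space M by (rule M)
  interpret lars_design Xtilde "diff_ix :: 'n set" by (rule lars_design_Xtilde)
  obtain n where kn: "k = Suc n" using k by (cases k) auto
  have len: "length es = Suc n" using k kn by simp
  define v where "v w = ytilde (y w)" for w
  define X where "X w = \<eta> \<bullet> y w" for w
  define Z where "Z w = orth_part \<eta> (y w)" for w
  have Em: "E \<in> sets M" using E_pos measure_notin_sets by fastforce
  have E0: "emeasure M E \<noteq> 0" using E_pos by (simp add: emeasure_eq_measure)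
  have E_witness: "\<exists>w\<in>E. P w" if "AE w in M. P w" for P
  proof (rule ccontr)
    assume "\<not> (\<exists>w\<in>E. P w)"
    then have "AE w in M. w \<notin> E" using that by (auto elim: AE_mp)
    then show False using E0 AE_iff_null_sets[OF Em] by auto
  qed
  have reach_iff: "w \<in> E \<longleftrightarrow> w \<in> space M \<and> lars_reaches Xtilde diff_ix (v w) es" for w
    by (simp add: E v_def)
  \<comment> \<open>The event has positive probability, so it contains a response outside any given null set; such
    responses show that \<open>es\<close> consists of distinct columns with admissible signs.\<close>
  obtain w0 where "w0 \<in> E" using E_witness[of "\<lambda>_. True"] by auto
  then have "lars_reaches Xtilde diff_ix (v w0) es" by (simp add: reach_iff)
  note reached = reaches_path[OF this]
  have in_span: "span (Xtilde ` active (take i es)) \<subseteq> span (Xtilde ` diff_ix)" for i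
    by (intro span_mono image_mono active_take_subset reached)
  have level_span: "Xtilde j - proj_on Xtilde (active es') (Xtilde j) \<in> span (Xtilde ` diff_ix)"
    if "j \<in> diff_ix" "active es' \<subseteq> diff_ix" for j es'
    using that lsq_in_span[of Xtilde "active es'"] span_mono[OF image_mono[OF that(2)], of Xtilde]
    by (intro span_diff) (auto simp: proj_on_def intro: span_base)
  have level_y: "level es' (v w) j = level es' (y w) j" if "j \<in> diff_ix" "active es' \<subseteq> diff_ix" for es' w j
    using span_Xtilde_inner_ytilde[OF level_span[OF that]] by (simp add: level_def v_def)
  have nondeg: "AE w in M. nondegenerate es (v w)"
  proof -
    have "AE w in M. level (take i es) (v w) (fst (es ! i)) \<noteq> 0" if i: "i < length es" for i
    proof -
      have A: "active (take i es) \<subseteq> diff_ix" by (rule active_take_subset[OF reached(2)])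
      have j: "fst (es ! i) \<in> diff_ix - active (take i es)"
        using not_active_take[OF reached(1) i] reached(2) i by auto
      show ?thesis
        using isotropic_nonzero[OF noise sigma level_direction_nonzero[OF A j], of \<mu>] j
        by (simp add: level_y[OF _ A]) (simp add: level_def y)
    qed
    then have "AE w in M. \<forall>i\<in>{..<length es}. level (take i es) (v w) (fst (es ! i)) \<noteq> 0"
      by (intro AE_finite_allI) auto
    then show ?thesis by (simp add: nondegenerate_def lessThan_iff Ball_def)
  qed
  have gen: "AE w in M. lars_generic Xtilde diff_ix (v w)" using generic by (simp add: v_def)
  have path: "signed_path es"
    using E_witness[OF AE_conjI[OF gen nondeg]] reaches_signed_path by (auto simp: reach_iff)
  have A: "active (take i es) \<subseteq> diff_ix" for i by (rule signed_pathD(2)[OF path])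
  have eta': "\<eta> = lars_c Xtilde (take n es) (fst (es ! n)) (snd (es ! n))" using eta kn by simp
  have eta_span: "\<eta> \<in> span (Xtilde ` active es)"
    using entry_direction_span[of n es] len by (simp add: eta')
  have eta0: "\<eta> \<noteq> 0"
    unfolding eta'
  proof (rule lars_c_nonzero[OF A])
    show "fst (es ! n) \<in> diff_ix - active (take n es)"
      using not_active_take[OF reached(1)] reached(2) len by auto
    show "snd (es ! n) \<noteq> slope (take n es) (fst (es ! n))" using signed_pathD(4)[OF path] len by simp
  qed
  \<comment> \<open>Moving the response along \<open>\<eta>\<close> changes the last entry value only.\<close>
  have y_decomp: "y w = Z w + (X w / (norm \<eta>)\<^sup>2) *\<^sub>R \<eta>" for w
    by (simp add: Z_def X_def orth_part_def)
  have entry_v: "entry_value es i (v w) = entry_value es i (y w)" if "i < length es" for i w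
    using span_Xtilde_inner_ytilde entry_direction_span[OF that] in_span[of "Suc i"]
    by (simp add: entry_value_def v_def) blast
  have entry_X: "entry_value es n (v w) = X w" for w
    using entry_v[of n w] len by (simp add: entry_value_def X_def eta')
  have lev: "level es (v w) j = level es (Z w) j" if j: "j \<in> diff_ix" for w j
    using level_y[OF j, of es w] level_invariant[OF _ eta_span] A[of "length es"] y_decomp[of w] by simp
  have ent: "entry_value es i (v w) = entry_value es i (Z w)" if i: "Suc i < length es" for i w
  proof -
    have "entry_value es i \<eta> = 0"
      using entry_value_orthogonal[OF path, of i n] i len by (simp add: eta')
    then have "entry_value es i (y w) = entry_value es i (Z w)"
      by (subst y_decomp) (simp add: entry_value_def inner_add_right)
    then show ?thesis using entry_v[of i w] i by simp
  qed
  have cong: "feasible es (v w) \<longleftrightarrow> feasible es (Z w)" "next_knot es (v w) u = next_knot es (Z w) u"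
      "prev_knot es (v w) = prev_knot es (Z w)" for w u
    by (rule selection_cong; use lev ent len in auto)+
  note indep = isotropic_direction(1)[OF noise sigma eta0, of \<mu>]
  have [measurable]: "\<epsilon> \<in> borel_measurable M" using distributed_measurable[OF noise] by simp
  then have [measurable]: "y \<in> borel_measurable M" by (simp add: y)
  have [measurable]: "v \<in> borel_measurable M"
    unfolding v_def by (rule measurable_compose[OF _ borel_measurable_ytilde]) simp
  interpret S: interval_selection M X Z "\<eta> \<bullet> \<mu>" "\<sigma> * norm \<eta>" E "Collect (feasible es)"
    "\<lambda>z. next_knot es z \<infinity>" "prev_knot es"
  proof
    show "indep_set (sets (vimage_algebra (space M) X borel)) (sets (vimage_algebra (space M) Z borel))"
      using indep by (simp add: X_def[abs_def] Z_def[abs_def] y)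
    show "Z \<in> borel_measurable M" unfolding Z_def orth_part_def by measurable
    show "distributed M lborel X (normal_density (\<eta> \<bullet> \<mu>) (\<sigma> * norm \<eta>))"
      using isotropic_direction(2)[OF noise sigma eta0, of \<mu>] by (simp add: X_def[abs_def] y)
    show "0 < \<sigma> * norm \<eta>" using sigma eta0 by simp
    show "(\<lambda>z. next_knot es z \<infinity>) \<in> borel_measurable borel"
      by (rule borel_measurable_next_knot) simp
    show "AE w in M. w \<in> E \<longleftrightarrow> Z w \<in> Collect (feasible es) \<and>
        next_knot es (Z w) \<infinity> < X w \<and> ereal (X w) < prev_knot es (Z w)"
      using gen AE_space
    proof eventually_elim
      case (elim w)
      then show ?case
        using reaches_iff_interval[OF path elim(1) len]
        by (simp add: reach_iff cong(1,2) cong(3) entry_X)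
    qed
  qed (use Em E0 feasible_sets borel_measurable_prev_knot in auto)
  have knots: "AE w in M. w \<in> E \<longrightarrow> lam n w = prev_knot es (Z w) \<and> lam (Suc n) w = ereal (X w) \<and>
      lam (Suc (Suc n)) w = ereal (next_knot es (Z w) \<infinity>)"
    using gen
  proof eventually_elim
    case (elim w)
    show ?case
      using lars_knots_at_reached[OF path elim len]
      by (auto simp: reach_iff lam v_def[symmetric] cong(2) cong(3) entry_X simp del: lars_knot.simps)
  qed
  have "truncation_interval M E y \<mu> \<sigma> \<eta> (lam (k + 1)) (lam (k - 1))"
    unfolding truncation_interval_def Let_def
  proof (intro conjI ballI)
    show "indep_set (sets (vimage_algebra (space M) (\<lambda>\<omega>. \<eta> \<bullet> y \<omega>) borel))
        (sets (vimage_algebra (space M) (\<lambda>\<omega>. orth_part \<eta> (y \<omega>)) borel))"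
      using indep by (simp add: y)
    fix B :: "real set" assume B: "B \<in> sets borel"
    show "AE \<omega> in uniform_measure M E.
        real_cond_exp (uniform_measure M E)
          (vimage_algebra (space (uniform_measure M E)) (\<lambda>\<omega>. orth_part \<eta> (y \<omega>)) borel)
          (indicator {\<omega> \<in> space (uniform_measure M E). \<eta> \<bullet> y \<omega> \<in> B}) \<omega> =
        measure (trunc_normal (\<eta> \<bullet> \<mu>) (\<sigma> * norm \<eta>) (lam (k + 1) \<omega>) (lam (k - 1) \<omega>)) B"
      using S.conditional_law[OF B] AE_uniform_measureI[OF Em knots]
    proof eventually_elim
      case (elim w)
      then show ?case by (simp add: S.cond_law_def kn X_def[abs_def] Z_def[abs_def])
    qed
  qed
  moreover have "T \<in> borel_measurable M"
  proof -
    have [measurable]: "lam i \<in> borel_measurable M" for i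
      using measurable_compose[OF \<open>v \<in> borel_measurable M\<close> borel_measurable_lars_knot[OF reached(2)]]
      by (simp add: lam v_def)
    show ?thesis unfolding T by measurable
  qed
  moreover have "distr (uniform_measure M E) borel T = uniform_measure lborel {0..1}" if "\<eta> \<bullet> \<mu> = 0"
  proof (rule S.pivot_uniform[OF that \<open>T \<in> borel_measurable M\<close>])
    have scale: "\<omega>\<^sub>k / \<sigma> = 1 / (\<sigma> * norm \<eta>)" by (simp add: omega field_simps)
    show "AE w in M. w \<in> E \<longrightarrow> T w =
      (Phi (prev_knot es (Z w) * ereal (1 / (\<sigma> * norm \<eta>))) - Phi (ereal (X w) * ereal (1 / (\<sigma> * norm \<eta>)))) /
      (Phi (prev_knot es (Z w) * ereal (1 / (\<sigma> * norm \<eta>))) -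
       Phi (ereal (next_knot es (Z w) \<infinity>) * ereal (1 / (\<sigma> * norm \<eta>))))"
      using knots by eventually_elim (simp add: T kn scale del: times_ereal.simps)
  qed
  ultimately show ?thesis by simp
qed

end
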